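(* Consider a family of $n$-qubit error-correcting codes for increasing $n$. Each code has a codespace $\mathsf C$ with code distance $d=d(n)$, a recovery map $\mathcal R$, and is subject to a Pauli noise model $\{E_\mu\}_{\mu=1}^N$ with uniform rates (all $\lambda_\mu$ equal), and the family has a tolerable error weight $h=h(n)$ for uniform Pauli noise (defined in the context). Then there exists $\xi=2^{-\Omega(d)}$ such that the logical error $\epsilon(t)$ for the global decoder with recovery rate $\kappa$ and noise rate $\Delta$ satisfies, for every $t\ge0$, $$\epsilon(t)\le1-\exp\Big(-(1-\xi)N\Delta s_1t-\xi(\kappa+N\Delta)t\Big),$$ where $s_1$ is determined by the solution $(s_v)_{v=0}^{h+1}$ of the recurrence relation $$s_v=\frac vN p_1s_{v-1}+\Big(1-\frac vN\Big)p_1s_{v+1}\quad(1\le v\le h),\qquad s_0=0,\quad s_{h+1}=1,$$ with $p_1=N\Delta/(\kappa+N\Delta)$.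
   Context: For each $n$, $\mathsf H=(\mathbb C^2)^{\otimes n}$ and $\mathsf C\subset\mathsf H$ is a subspace (codespace). $N$, $\kappa>0$, $\Delta>0$ may depend on $n$. Noise. $\mathcal L_E(\rho)=\sum_{\mu=1}^N\lambda_\mu\big(E_\mu\rho E_\mu^\dagger-\tfrac12\{E_\mu^\dagger E_\mu,\rho\}\big)$ with $\lambda_\mu>0$, $\sum_\mu\lambda_\mu=N$; uniform rates thus mean $\lambda_\mu=1$ for all $\mu$. Pauli noise means that every $E_\mu$ is a multi-qubit Pauli operator (tensor product of $I,X,Y,Z$). Recovery (global decoder). $\mathcal R$ is a CPTP map with output supported on $\mathsf C$, $\mathcal R^2=\mathcal R$, and $\mathcal R(\rho_0)=\rho_0$ for every density operator $\rho_0$ supported on $\mathsf C$. The recovery Lindbladian is $\mathcal L_R(\rho)=\kappa(\mathcal R(\rho)-\rho)$; the full dynamics is generated by $\mathcal L=\mathcal L_R+\Delta\mathcal L_E$. Logical error. $\epsilon(t)=1-\min_{|\psi_0\rangle\in\mathsf C}\mathrm{Tr}\big(|\psi_0\rangle\langle\psi_0|\,\mathcal R e^{\mathcal Lt}(|\psi_0\rangle\langle\psi_0|)\big)$, min over unit vectors. Tolerable error weight for uniform Pauli noise. Let $\mathcal Q_0=\mathcal I$ be the identity channel and, for $k\ge1$, $\mathcal Q_k(\cdot)=\frac1{|\mathbf S_k|}\sum_{S\in\mathbf S_k}E_S(\cdot)E_S^\dagger$, where $\mathbf S_k$ is the set of all $k$-element subsets $S$ of the error indices $\{1,\dots,N\}$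 and $E_S=\prod_{\mu\in S}E_\mu$ (the order is irrelevant for $\mathcal Q_k$ since Paulis commute up to sign). An integer-valued function $h=h(n)$ is a tolerable error weight for uniform Pauli noise if there is $\xi=\xi(n)\in[0,1]$, independent of the state, with $\xi=2^{-\Omega(d)}$ (i.e. for some constant $c>0$, $\xi(n)\le2^{-c\,d(n)}$ for all sufficiently large $n$), such that for every unit vector $|\psi\rangle\in\mathsf C$ and every integer $0\le k\le h$, $\mathcal R\mathcal Q_k(|\psi\rangle\langle\psi|)-(1-\xi)|\psi\rangle\langle\psi|\ge0$ (positive semidefinite). *)

theory Defs
  imports Complex_Main "Jordan_Normal_Form.Schur_Decomposition" "Jordan_Normal_Form.VS_Connect"
begin

text \<open>
  States of \<open>n\<close> qubits are vectors in \<open>carrier_vec (2 ^ n)\<close>, operators are matrices in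
  \<open>carrier_mat (2 ^ n) (2 ^ n)\<close>, and superoperators are functions on matrices whose behaviour
  outside this carrier is irrelevant. In \<open>v \<bullet>c w\<close> it is the second argument that is conjugated, so
  \<open>\<langle>w|A v\<rangle>\<close> is written \<open>(A *\<^sub>v v) \<bullet>c w\<close>.
\<close>

definition mat_trace :: "complex mat \<Rightarrow> complex" where
  "mat_trace A = (\<Sum>i<dim_row A. A $$ (i, i))"

definition mat_sum :: "nat \<Rightarrow> ('a \<Rightarrow> complex mat) \<Rightarrow> 'a set \<Rightarrow> complex mat" where
  "mat_sum D F A = mat D D (\<lambda>(i, j). \<Sum>a\<in>A. F a $$ (i, j))"

definition ket_bra :: "complex vec \<Rightarrow> complex mat" where
  "ket_bra v = mat (dim_vec v) (dim_vec v) (\<lambda>(i, j). v $ i * cnj (v $ j))"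

text \<open>On \<open>complex\<close>, \<open>0 \<le> z\<close> says that \<open>z\<close> is real and nonnegative.\<close>

definition psd :: "nat \<Rightarrow> complex mat \<Rightarrow> bool" where
  "psd D A \<longleftrightarrow> A \<in> carrier_mat D D \<and> (\<forall>v\<in>carrier_vec D. 0 \<le> (A *\<^sub>v v) \<bullet>c v)"

definition density_operator :: "nat \<Rightarrow> complex mat \<Rightarrow> bool" where
  "density_operator D \<rho> \<longleftrightarrow> psd D \<rho> \<and> mat_trace \<rho> = 1"

definition supported_on :: "nat \<Rightarrow> complex mat \<Rightarrow> complex vec set \<Rightarrow> bool" where
  "supported_on D \<rho> C \<longleftrightarrow> (\<forall>v\<in>carrier_vec D. \<rho> *\<^sub>v v \<in> C)"

text \<open>
  \<open>ampliation m D \<Phi>\<close> is \<open>id \<otimes> \<Phi>\<close> on \<open>\<complex>\<^sup>m \<otimes> \<complex>\<^sup>D\<close>: it applies \<open>\<Phi>\<close> to each \<open>D \<times> D\<close> block of an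
  \<open>m D \<times> m D\<close> matrix.
\<close>

definition block :: "nat \<Rightarrow> complex mat \<Rightarrow> nat \<Rightarrow> nat \<Rightarrow> complex mat" where
  "block D X a b = mat D D (\<lambda>(i, j). X $$ (a * D + i, b * D + j))"

definition ampliation ::
    "nat \<Rightarrow> nat \<Rightarrow> (complex mat \<Rightarrow> complex mat) \<Rightarrow> complex mat \<Rightarrow> complex mat" where
  "ampliation m D \<Phi> X =
     mat (m * D) (m * D) (\<lambda>(i, j). \<Phi> (block D X (i div D) (j div D)) $$ (i mod D, j mod D))"

definition linear_superop :: "nat \<Rightarrow> (complex mat \<Rightarrow> complex mat) \<Rightarrow> bool" where
  "linear_superop D \<Phi> \<longleftrightarrow>
     (\<forall>X\<in>carrier_mat D D. \<Phi> X \<in> carrier_mat D D) \<and>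
     (\<forall>X\<in>carrier_mat D D. \<forall>Y\<in>carrier_mat D D. \<Phi> (X + Y) = \<Phi> X + \<Phi> Y) \<and>
     (\<forall>X\<in>carrier_mat D D. \<forall>a. \<Phi> (a \<cdot>\<^sub>m X) = a \<cdot>\<^sub>m \<Phi> X)"

definition completely_positive :: "nat \<Rightarrow> (complex mat \<Rightarrow> complex mat) \<Rightarrow> bool" where
  "completely_positive D \<Phi> \<longleftrightarrow> (\<forall>m X. psd (m * D) X \<longrightarrow> psd (m * D) (ampliation m D \<Phi> X))"

definition trace_preserving :: "nat \<Rightarrow> (complex mat \<Rightarrow> complex mat) \<Rightarrow> bool" where
  "trace_preserving D \<Phi> \<longleftrightarrow> (\<forall>X\<in>carrier_mat D D. mat_trace (\<Phi> X) = mat_trace X)"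

definition cptp :: "nat \<Rightarrow> (complex mat \<Rightarrow> complex mat) \<Rightarrow> bool" where
  "cptp D \<Phi> \<longleftrightarrow> linear_superop D \<Phi> \<and> completely_positive D \<Phi> \<and> trace_preserving D \<Phi>"

text \<open>\<open>superop_exp D L t\<close> is \<open>e\<^bsup>Lt\<^esup>\<close>, as an entrywise power series.\<close>

definition superop_exp ::
    "nat \<Rightarrow> (complex mat \<Rightarrow> complex mat) \<Rightarrow> real \<Rightarrow> complex mat \<Rightarrow> complex mat" where
  "superop_exp D L t X =
     mat D D (\<lambda>(i, j). \<Sum>k. of_real (t ^ k / fact k) * (L ^^ k) X $$ (i, j))"

definition codespace :: "nat \<Rightarrow> complex vec set \<Rightarrow> bool" where
  "codespace n C \<longleftrightarrow>
     VectorSpace.subspace class_ring C (module_vec TYPE(complex) (2 ^ n))"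

datatype pauli = PauliI | PauliX | PauliY | PauliZ

fun pauli_mat :: "pauli \<Rightarrow> complex mat" where
  "pauli_mat PauliI = mat_of_rows_list 2 [[1, 0], [0, 1]]"
| "pauli_mat PauliX = mat_of_rows_list 2 [[0, 1], [1, 0]]"
| "pauli_mat PauliY = mat_of_rows_list 2 [[0, - \<i>], [\<i>, 0]]"
| "pauli_mat PauliZ = mat_of_rows_list 2 [[1, 0], [0, - 1]]"

definition kron :: "complex mat \<Rightarrow> complex mat \<Rightarrow> complex mat" where
  "kron A B = mat (dim_row A * dim_row B) (dim_col A * dim_col B)
     (\<lambda>(i, j). A $$ (i div dim_row B, j div dim_col B) * B $$ (i mod dim_row B, j mod dim_col B))"

fun pauli_string :: "pauli list \<Rightarrow> complex mat" where
  "pauli_string [] = 1\<^sub>m 1"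
| "pauli_string (p # ps) = kron (pauli_mat p) (pauli_string ps)"

definition pauli_weight :: "pauli list \<Rightarrow> nat" where
  "pauli_weight ps = length (filter (\<lambda>p. p \<noteq> PauliI) ps)"

text \<open>The Knill-Laflamme condition for error detection, \<open>\<Pi> A \<Pi> = c \<Pi>\<close> with \<open>\<Pi>\<close> the projector
  onto \<open>C\<close>, in terms of matrix elements.\<close>

definition detectable :: "complex vec set \<Rightarrow> complex mat \<Rightarrow> bool" where
  "detectable C A \<longleftrightarrow> (\<exists>c. \<forall>\<phi>\<in>C. \<forall>\<psi>\<in>C. (A *\<^sub>v \<psi>) \<bullet>c \<phi> = c * (\<psi> \<bullet>c \<phi>))"

text \<open>
  The least weight of an undetectable Pauli string. A code of dimension at least 2 has one of
  weight at most \<open>n\<close>; in a code of dimension 1 everything is detectable, and the distance is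
  \<open>n + 1\<close> by convention.
\<close>

definition code_distance :: "nat \<Rightarrow> complex vec set \<Rightarrow> nat" where
  "code_distance n C =
     (LEAST w. w = n + 1 \<or>
        (\<exists>ps. length ps = n \<and> pauli_weight ps = w \<and> \<not> detectable C (pauli_string ps)))"

definition noise_lindbladian ::
    "nat \<Rightarrow> nat \<Rightarrow> (nat \<Rightarrow> real) \<Rightarrow> (nat \<Rightarrow> complex mat) \<Rightarrow> complex mat \<Rightarrow> complex mat" where
  "noise_lindbladian n N rate E \<rho> = mat_sum (2 ^ n)
     (\<lambda>\<mu>. of_real (rate \<mu>) \<cdot>\<^sub>m
        (E \<mu> * \<rho> * mat_adjoint (E \<mu>) -
         (1 / 2) \<cdot>\<^sub>m (mat_adjoint (E \<mu>) * E \<mu> * \<rho> + \<rho> * (mat_adjoint (E \<mu>) * E \<mu>)))) {1..N}"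

definition noise_rates :: "nat \<Rightarrow> (nat \<Rightarrow> real) \<Rightarrow> bool" where
  "noise_rates N rate \<longleftrightarrow> (\<forall>\<mu>\<in>{1..N}. rate \<mu> > 0) \<and> (\<Sum>\<mu>=1..N. rate \<mu>) = real N"

definition uniform_rates :: "nat \<Rightarrow> (nat \<Rightarrow> real) \<Rightarrow> bool" where
  "uniform_rates N rate \<longleftrightarrow> (\<forall>\<mu>\<in>{1..N}. \<forall>\<nu>\<in>{1..N}. rate \<mu> = rate \<nu>)"

definition pauli_noise :: "nat \<Rightarrow> nat \<Rightarrow> (nat \<Rightarrow> complex mat) \<Rightarrow> bool" where
  "pauli_noise n N E \<longleftrightarrow> (\<forall>\<mu>\<in>{1..N}. \<exists>ps. length ps = n \<and> E \<mu> = pauli_string ps)"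

definition recovery_map ::
    "nat \<Rightarrow> complex vec set \<Rightarrow> (complex mat \<Rightarrow> complex mat) \<Rightarrow> bool" where
  "recovery_map n C R \<longleftrightarrow>
     cptp (2 ^ n) R \<and>
     (\<forall>\<rho>. density_operator (2 ^ n) \<rho> \<longrightarrow> supported_on (2 ^ n) (R \<rho>) C) \<and>
     (\<forall>X\<in>carrier_mat (2 ^ n) (2 ^ n). R (R X) = R X) \<and>
     (\<forall>\<rho>. density_operator (2 ^ n) \<rho> \<and> supported_on (2 ^ n) \<rho> C \<longrightarrow> R \<rho> = \<rho>)"

definition recovery_lindbladian ::
    "real \<Rightarrow> (complex mat \<Rightarrow> complex mat) \<Rightarrow> complex mat \<Rightarrow> complex mat" where
  "recovery_lindbladian \<kappa> R \<rho> = of_real \<kappa> \<cdot>\<^sub>m (R \<rho> - \<rho>)"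

definition full_lindbladian ::
    "nat \<Rightarrow> nat \<Rightarrow> (nat \<Rightarrow> real) \<Rightarrow> (nat \<Rightarrow> complex mat) \<Rightarrow> (complex mat \<Rightarrow> complex mat) \<Rightarrow>
     real \<Rightarrow> real \<Rightarrow> complex mat \<Rightarrow> complex mat" where
  "full_lindbladian n N rate E R \<kappa> \<Delta> \<rho> =
     recovery_lindbladian \<kappa> R \<rho> + of_real \<Delta> \<cdot>\<^sub>m noise_lindbladian n N rate E \<rho>"

definition unit_vectors :: "complex vec set \<Rightarrow> complex vec set" where
  "unit_vectors C = {\<psi> \<in> C. \<psi> \<bullet>c \<psi> = 1}"

text \<open>The infimum below is a minimum, as the unit sphere of \<open>C\<close> is compact; it is nonempty because
  a recovery map onto \<open>C\<close> exists only if \<open>C\<close> is not the zero space.\<close>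

definition logical_error ::
    "nat \<Rightarrow> complex vec set \<Rightarrow> (complex mat \<Rightarrow> complex mat) \<Rightarrow>
     (complex mat \<Rightarrow> complex mat) \<Rightarrow> real \<Rightarrow> real" where
  "logical_error n C R L t =
     1 - (INF \<psi>\<in>unit_vectors C.
            Re (mat_trace (ket_bra \<psi> * R (superop_exp (2 ^ n) L t (ket_bra \<psi>)))))"

definition error_product :: "nat \<Rightarrow> (nat \<Rightarrow> complex mat) \<Rightarrow> nat set \<Rightarrow> complex mat" where
  "error_product n E S = foldr (\<lambda>\<mu> A. E \<mu> * A) (sorted_list_of_set S) (1\<^sub>m (2 ^ n))"

definition error_subsets :: "nat \<Rightarrow> nat \<Rightarrow> nat set set" where
  "error_subsets N k = {S. S \<subseteq> {1..N} \<and> card S = k}"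

text \<open>For \<open>k = 0\<close> the only subset is \<open>{}\<close>, and this is the identity channel.\<close>

definition weight_channel ::
    "nat \<Rightarrow> nat \<Rightarrow> (nat \<Rightarrow> complex mat) \<Rightarrow> nat \<Rightarrow> complex mat \<Rightarrow> complex mat" where
  "weight_channel n N E k \<rho> =
     (1 / of_nat (card (error_subsets N k))) \<cdot>\<^sub>m
       mat_sum (2 ^ n) (\<lambda>S. error_product n E S * \<rho> * mat_adjoint (error_product n E S))
         (error_subsets N k)"

text \<open>\<open>x = 2\<^bsup>-\<Omega>(d)\<^esup>\<close> for a family indexed by the qubit numbers in \<open>I\<close>.\<close>

definition exp_small :: "nat set \<Rightarrow> (nat \<Rightarrow> nat) \<Rightarrow> (nat \<Rightarrow> real) \<Rightarrow> bool" where
  "exp_small I d x \<longleftrightarrow>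
     (\<exists>c>0. \<forall>\<^sub>F n in sequentially. n \<in> I \<longrightarrow> x n \<le> 2 powr (- c * real (d n)))"

text \<open>The condition \<open>h n \<le> N n\<close> makes the average over \<open>k\<close>-element subsets meaningful for all
  \<open>k \<le> h n\<close>.\<close>

definition tolerable_error_weight ::
    "nat set \<Rightarrow> (nat \<Rightarrow> complex vec set) \<Rightarrow> (nat \<Rightarrow> nat) \<Rightarrow> (nat \<Rightarrow> complex mat \<Rightarrow> complex mat) \<Rightarrow>
     (nat \<Rightarrow> nat) \<Rightarrow> (nat \<Rightarrow> nat \<Rightarrow> complex mat) \<Rightarrow> (nat \<Rightarrow> nat) \<Rightarrow> bool" where
  "tolerable_error_weight I C d R N E h \<longleftrightarrow>
     (\<forall>n\<in>I. h n \<le> N n) \<and>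
     (\<exists>\<xi>. (\<forall>n\<in>I. 0 \<le> \<xi> n \<and> \<xi> n \<le> 1) \<and> exp_small I d \<xi> \<and>
        (\<forall>n\<in>I. \<forall>\<psi>\<in>unit_vectors (C n). \<forall>k\<le>h n.
           psd (2 ^ n) (R n (weight_channel n (N n) (E n) k (ket_bra \<psi>))
                        - of_real (1 - \<xi> n) \<cdot>\<^sub>m ket_bra \<psi>)))"

end

theory Submission
  imports Defs
begin

text \<open>
  For uniform Pauli noise the Lindbladian is \<open>K - (\<kappa> + N \<Delta>)\<close>, where
  \<open>K X = \<kappa> R X + \<Delta> \<Sum>\<^sub>\<mu> E\<^sub>\<mu> X E\<^sub>\<mu>\<^sup>\<dagger>\<close> preserves positivity. The noise part of \<open>K\<close> acts on the channels
  \<open>Q\<^sub>v\<close> as a random walk, \<open>v Q\<^bsub>v-1\<^esub> + (N - v) Q\<^bsub>v+1\<^esub>\<close>, and \<open>R\<close> resets \<open>Q\<^sub>v\<close> (\<open>v \<le> h\<close>) to weight \<open>0\<close> up to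
  a factor \<open>1 - \<xi>\<close>. Dropping positive terms, the fidelity after \<open>m\<close> applications of \<open>K\<close> is bounded
  below by \<open>r\<^sup>m\<close> times the value at the initial weight of any nonnegative \<open>f\<close> for which the walk
  killed at \<open>h + 1\<close> gives at least \<open>r f\<close>. The recurrence makes \<open>f 0 = 1\<close>, \<open>f v = (1 - \<xi>) (1 - s\<^sub>v)\<close>
  such a function with \<open>r = \<kappa> + N \<Delta> (1 - \<xi>) (1 - s\<^sub>1)\<close>, and summing the exponential series gives the
  bound with the same \<open>\<xi>\<close>.
\<close>

section \<open>Pauli strings\<close>

lemma mat_adjoint_dim [simp]:
  "dim_row (mat_adjoint A) = dim_col A" "dim_col (mat_adjoint A) = dim_row A"
  by (simp_all add: mat_adjoint_def)

lemma mat_adjoint_carrier [simp]: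
  "A \<in> carrier_mat n m \<Longrightarrow> mat_adjoint A \<in> carrier_mat m n"
  by (rule carrier_matI) (simp_all only: mat_adjoint_dim carrier_matD)

lemma mat_adjoint_index:
  "i < dim_col A \<Longrightarrow> j < dim_row A \<Longrightarrow> mat_adjoint A $$ (i, j) = conjugate (A $$ (j, i))"
  unfolding mat_adjoint_def by (subst mat_of_rows_index) simp_all

lemma kron_carrier:
  "A \<in> carrier_mat m m' \<Longrightarrow> B \<in> carrier_mat p p' \<Longrightarrow> kron A B \<in> carrier_mat (m * p) (m' * p')"
  unfolding kron_def by auto

text \<open>The numbers below \<open>m * p\<close> correspond to pairs through
  \<open>i * p + j\<close>. This is the index bookkeeping of Kronecker products: it turns the sum
  over an intermediate index of the large matrix into a double sum.\<close>

lemma sum_div_mod: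
  fixes f :: "nat \<Rightarrow> nat \<Rightarrow> 'a :: comm_monoid_add"
  shows "(\<Sum>k\<in>{0..<m * p}. f (k div p) (k mod p)) = (\<Sum>i\<in>{0..<m}. \<Sum>j\<in>{0..<p}. f i j)"
proof -
  have "(\<Sum>i\<in>{0..<m}. \<Sum>j\<in>{0..<p}. f i j) = (\<Sum>(i, j)\<in>{0..<m} \<times> {0..<p}. f i j)"
    by (simp add: sum.cartesian_product)
  also have "\<dots> = (\<Sum>k\<in>{0..<m * p}. f (k div p) (k mod p))"
  proof (rule sum.reindex_bij_witness[where i = "\<lambda>k. (k div p, k mod p)" and j = "\<lambda>(i, j). i * p + j"],
      goal_cases)
    case (2 a)
    obtain i j where a: "a = (i, j)" by force
    with 2 have "i < m" "j < p" by auto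
    then have "i * p + j < Suc i * p" by simp
    also have "\<dots> \<le> m * p" using \<open>i < m\<close> by (intro mult_le_mono1) simp
    finally show ?case using a by simp
  next
    case (4 k)
    then have "p > 0" by (cases p) auto
    with 4 show ?case by (auto simp: less_mult_imp_div_less)
  qed auto
  finally show ?thesis ..
qed

text \<open>The mixed-product rule: after the intermediate index is split into quotient and
  remainder, the double sum factors. It reduces identities of Pauli strings to identities of their
  letters.\<close>

lemma kron_mult:
  assumes "A \<in> carrier_mat m m" "C \<in> carrier_mat m m" "B \<in> carrier_mat p p" "D \<in> carrier_mat p p"
  shows "kron A B * kron C D = kron (A * C) (B * D)"
proof (rule eq_matI)
  fix i j assume "i < dim_row (kron (A * C) (B * D))" "j < dim_col (kron (A * C) (B * D))"
  then have ij: "i < m * p" "j < m * p" using assms by (auto simp: kron_def)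
  then have p: "p > 0" by (cases p) auto
  have dm: "i div p < m" "j div p < m" "i mod p < p" "j mod p < p"
    using ij p by (auto simp: less_mult_imp_div_less)
  have "(kron A B * kron C D) $$ (i, j) = (\<Sum>k\<in>{0..<m * p}.
      (A $$ (i div p, k div p) * B $$ (i mod p, k mod p)) *
      (C $$ (k div p, j div p) * D $$ (k mod p, j mod p)))"
    using assms ij by (auto simp: kron_def scalar_prod_def intro!: sum.cong)
  also have "\<dots> = (\<Sum>a\<in>{0..<m}. \<Sum>b\<in>{0..<p}. (A $$ (i div p, a) * B $$ (i mod p, b)) *
      (C $$ (a, j div p) * D $$ (b, j mod p)))"
    by (rule sum_div_mod)
  also have "\<dots> = (\<Sum>a\<in>{0..<m}. A $$ (i div p, a) * C $$ (a, j div p)) *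
      (\<Sum>b\<in>{0..<p}. B $$ (i mod p, b) * D $$ (b, j mod p))"
    by (simp add: sum_product mult_ac)
  also have "\<dots> = kron (A * C) (B * D) $$ (i, j)"
    using assms ij dm by (auto simp: kron_def scalar_prod_def)
  finally show "(kron A B * kron C D) $$ (i, j) = kron (A * C) (B * D) $$ (i, j)" .
qed (use assms in \<open>auto simp: kron_def\<close>)

lemma kron_smult:
  "kron (a \<cdot>\<^sub>m A) (b \<cdot>\<^sub>m B) = (a * b) \<cdot>\<^sub>m kron A B"
proof (rule eq_matI)
  fix i j assume "i < dim_row ((a * b) \<cdot>\<^sub>m kron A B)" "j < dim_col ((a * b) \<cdot>\<^sub>m kron A B)"
  then have ij: "i < dim_row A * dim_row B" "j < dim_col A * dim_col B" by (auto simp: kron_def)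
  then have "dim_row B > 0" "dim_col B > 0" by (auto intro: Nat.gr0I)
  then show "kron (a \<cdot>\<^sub>m A) (b \<cdot>\<^sub>m B) $$ (i, j) = ((a * b) \<cdot>\<^sub>m kron A B) $$ (i, j)"
    using ij by (auto simp: kron_def less_mult_imp_div_less)
qed (auto simp: kron_def)

lemma mat_adjoint_kron: "mat_adjoint (kron A B) = kron (mat_adjoint A) (mat_adjoint B)"
proof (rule eq_matI)
  fix i j assume "i < dim_row (kron (mat_adjoint A) (mat_adjoint B))"
    "j < dim_col (kron (mat_adjoint A) (mat_adjoint B))"
  then have ij: "i < dim_col A * dim_col B" "j < dim_row A * dim_row B"
    by (auto simp: kron_def)
  then have "dim_row B > 0" "dim_col B > 0" by (auto intro: Nat.gr0I)
  then have dm: "i div dim_col B < dim_col A" "i mod dim_col B < dim_col B"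
    "j div dim_row B < dim_row A" "j mod dim_row B < dim_row B"
    using ij by (simp_all add: less_mult_imp_div_less)
  have "mat_adjoint (kron A B) $$ (i, j) = conjugate (kron A B $$ (j, i))"
    by (rule mat_adjoint_index) (use ij in \<open>simp_all add: kron_def\<close>)
  also have "\<dots> = conjugate (A $$ (j div dim_row B, i div dim_col B)) *
      conjugate (B $$ (j mod dim_row B, i mod dim_col B))"
    using ij by (simp add: kron_def)
  also have "\<dots> = mat_adjoint A $$ (i div dim_col B, j div dim_row B) *
      mat_adjoint B $$ (i mod dim_col B, j mod dim_row B)"
    using dm by (simp only: mat_adjoint_index)
  also have "\<dots> = kron (mat_adjoint A) (mat_adjoint B) $$ (i, j)"
    using ij by (simp add: kron_def)
  finally show "mat_adjoint (kron A B) $$ (i, j) = kron (mat_adjoint A) (mat_adjoint B) $$ (i, j)" .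
qed (simp_all add: kron_def)

section \<open>The single-qubit Pauli matrices\<close>

lemma pauli_mat_carrier [simp]: "pauli_mat p \<in> carrier_mat 2 2"
  by (cases p) (auto simp: mat_of_rows_list_def)

lemma mat_2_eqI:
  assumes "A \<in> carrier_mat 2 2" "B \<in> carrier_mat 2 2"
    "A $$ (0, 0) = B $$ (0, 0)" "A $$ (0, 1) = B $$ (0, 1)"
    "A $$ (1, 0) = B $$ (1, 0)" "A $$ (1, 1) = B $$ (1, 1)"
  shows "A = B"
  using assms by (intro eq_matI) (auto simp: less_2_cases_iff)

lemma mult_mat_2_index:
  assumes "A \<in> carrier_mat 2 2" "B \<in> carrier_mat 2 2" "i < 2" "j < 2"
  shows "(A * B) $$ (i, j) = A $$ (i, 0) * B $$ (0, j) + A $$ (i, 1) * B $$ (1, j)"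
  using assms by (simp add: scalar_prod_def numeral_2_eq_2)

text \<open>With the entries as \<open>case\<close> expressions, an identity of single-qubit
  matrices becomes four scalar equations that \<open>pauli.split\<close> settles letter by letter.
  The index one is written \<open>Suc 0\<close>, the form to which the simplifier still rewrites it
  here.\<close>

lemma pauli_mat_entries:
  "pauli_mat p $$ (0, 0) = (case p of PauliI \<Rightarrow> 1 | PauliX \<Rightarrow> 0 | PauliY \<Rightarrow> 0 | PauliZ \<Rightarrow> 1)"
  "pauli_mat p $$ (0, Suc 0) = (case p of PauliI \<Rightarrow> 0 | PauliX \<Rightarrow> 1 | PauliY \<Rightarrow> - \<i> | PauliZ \<Rightarrow> 0)"
  "pauli_mat p $$ (Suc 0, 0) = (case p of PauliI \<Rightarrow> 0 | PauliX \<Rightarrow> 1 | PauliY \<Rightarrow> \<i> | PauliZ \<Rightarrow> 0)"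
  "pauli_mat p $$ (Suc 0, Suc 0) = (case p of PauliI \<Rightarrow> 1 | PauliX \<Rightarrow> 0 | PauliY \<Rightarrow> 0 | PauliZ \<Rightarrow> - 1)"
  by (cases p; simp add: mat_of_rows_list_def)+

lemma pauli_mat_mult_index:
  assumes "i < 2" "j < 2"
  shows "(pauli_mat p * pauli_mat q) $$ (i, j) =
    pauli_mat p $$ (i, 0) * pauli_mat q $$ (0, j) + pauli_mat p $$ (i, Suc 0) * pauli_mat q $$ (Suc 0, j)"
  using mult_mat_2_index[OF pauli_mat_carrier pauli_mat_carrier assms] by simp

lemma pauli_mat_mult_carrier: "pauli_mat p * pauli_mat q \<in> carrier_mat 2 2"
  by (rule mult_carrier_mat[OF pauli_mat_carrier pauli_mat_carrier])

lemma pauli_mat_square: "pauli_mat p * pauli_mat p = 1\<^sub>m 2"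
proof (rule mat_2_eqI)
  show "pauli_mat p * pauli_mat p \<in> carrier_mat 2 2" by (rule pauli_mat_mult_carrier)
qed (simp_all add: pauli_mat_mult_index pauli_mat_entries split: pauli.split
    del: pauli_mat.simps index_mult_mat(1))

lemma pauli_mat_adjoint: "mat_adjoint (pauli_mat p) = pauli_mat p"
proof (rule mat_2_eqI)
  show "mat_adjoint (pauli_mat p) \<in> carrier_mat 2 2"
    by (rule mat_adjoint_carrier[OF pauli_mat_carrier])
qed (simp_all add: mat_adjoint_index carrier_matD[OF pauli_mat_carrier] pauli_mat_entries
    split: pauli.split del: pauli_mat.simps)

lemma pauli_mat_commute:
  "\<exists>c\<in>{1, -1}. pauli_mat p * pauli_mat q = c \<cdot>\<^sub>m (pauli_mat q * pauli_mat p)"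
proof
  \<comment> \<open>Two distinct letters other than the identity anticommute; every other pair
    commutes.\<close>
  let ?c = "if p = q \<or> p = PauliI \<or> q = PauliI then 1 else - 1 :: complex"
  show "pauli_mat p * pauli_mat q = ?c \<cdot>\<^sub>m (pauli_mat q * pauli_mat p)"
  proof (rule mat_2_eqI)
    show "pauli_mat p * pauli_mat q \<in> carrier_mat 2 2" by (rule pauli_mat_mult_carrier)
    show "?c \<cdot>\<^sub>m (pauli_mat q * pauli_mat p) \<in> carrier_mat 2 2"
      by (rule smult_carrier_mat[OF pauli_mat_mult_carrier])
  qed (simp_all add: pauli_mat_mult_index pauli_mat_entries carrier_matD[OF pauli_mat_carrier]
      split: pauli.split del: pauli_mat.simps index_mult_mat(1))
qed simp

section \<open>Pauli strings: Hermitian involutions that commute up to sign\<close>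

lemma pauli_string_carrier:
  "pauli_string ps \<in> carrier_mat (2 ^ length ps) (2 ^ length ps)"
proof (induction ps)
  case (Cons p ps)
  from kron_carrier[OF pauli_mat_carrier this] show ?case
    by (simp only: pauli_string.simps list.size power_Suc add_Suc_right add_0_right)
qed auto

lemma kron_one: "kron (1\<^sub>m m) (1\<^sub>m p) = 1\<^sub>m (m * p)"
proof (rule eq_matI)
  fix i j assume "i < dim_row (1\<^sub>m (m * p))" "j < dim_col (1\<^sub>m (m * p))"
  then have ij: "i < m * p" "j < m * p" by auto
  then have "p > 0" by (cases p) auto
  moreover have "i = j \<longleftrightarrow> i div p = j div p \<and> i mod p = j mod p"
    by (metis div_mult_mod_eq)
  ultimately show "kron (1\<^sub>m m) (1\<^sub>m p) $$ (i, j) = 1\<^sub>m (m * p) $$ (i, j)"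
    using ij by (auto simp: kron_def less_mult_imp_div_less)
qed (auto simp: kron_def)

lemma pauli_string_square:
  "pauli_string ps * pauli_string ps = 1\<^sub>m (2 ^ length ps)"
proof (induction ps)
  case (Cons p ps)
  then show ?case
    unfolding pauli_string.simps
      kron_mult[OF pauli_mat_carrier pauli_mat_carrier pauli_string_carrier pauli_string_carrier]
      pauli_mat_square by (simp add: kron_one)
qed simp

lemma mat_adjoint_one: "mat_adjoint (1\<^sub>m n :: complex mat) = 1\<^sub>m n"
  by (rule eq_matI) (auto simp: mat_adjoint_index)

lemma pauli_string_adjoint: "mat_adjoint (pauli_string ps) = pauli_string ps"
  by (induction ps) (simp_all only: pauli_string.simps mat_adjoint_kron mat_adjoint_one pauli_mat_adjoint)

text \<open>The signs of the tensor factors multiply. Only the existence of a sign is recorded,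
  since conjugation by a product of errors does not see it.\<close>

lemma pauli_string_commute:
  assumes "length ps = length qs"
  shows "\<exists>c\<in>{1, -1}. pauli_string ps * pauli_string qs = c \<cdot>\<^sub>m (pauli_string qs * pauli_string ps)"
  using assms
proof (induction ps qs rule: list_induct2)
  case Nil
  show ?case by (auto intro: bexI[of _ 1])
next
  case (Cons p ps q qs)
  from pauli_mat_commute[of p q] obtain c where c: "c \<in> {1, -1}"
    "pauli_mat p * pauli_mat q = c \<cdot>\<^sub>m (pauli_mat q * pauli_mat p)"
    by (rule bexE)
  from Cons.IH obtain e where e: "e \<in> {1, -1}"
    "pauli_string ps * pauli_string qs = e \<cdot>\<^sub>m (pauli_string qs * pauli_string ps)"
    by (rule bexE)
  note cs = pauli_string_carrier[of ps] pauli_string_carrier[of qs, folded \<open>length ps = length qs\<close>]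
  have "pauli_string (p # ps) * pauli_string (q # qs)
      = kron (pauli_mat p * pauli_mat q) (pauli_string ps * pauli_string qs)"
    by (simp only: pauli_string.simps kron_mult[OF pauli_mat_carrier pauli_mat_carrier cs])
  also have "\<dots> = (c * e) \<cdot>\<^sub>m kron (pauli_mat q * pauli_mat p) (pauli_string qs * pauli_string ps)"
    unfolding c(2) e(2) kron_smult ..
  also have "\<dots> = (c * e) \<cdot>\<^sub>m (pauli_string (q # qs) * pauli_string (p # ps))"
    by (simp only: pauli_string.simps kron_mult[OF pauli_mat_carrier pauli_mat_carrier cs(2) cs(1)])
  finally show ?case using c(1) e(1) by (intro bexI[of _ "c * e"]) auto
qed

declare One_nat_def [simp del]

section \<open>Conjugation and linear superoperators\<close>

lemma mat_adjoint_mult: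
  fixes A B :: "complex mat"
  assumes "A \<in> carrier_mat l m" "B \<in> carrier_mat m p"
  shows "mat_adjoint (A * B) = mat_adjoint B * mat_adjoint A"
proof (rule eq_matI)
  fix i j assume "i < dim_row (mat_adjoint B * mat_adjoint A)" "j < dim_col (mat_adjoint B * mat_adjoint A)"
  then have ij: "i < p" "j < l" using assms by simp_all
  have "mat_adjoint (A * B) $$ (i, j) = (\<Sum>k\<in>{0..<m}. cnj (A $$ (j, k)) * cnj (B $$ (k, i)))"
    using assms ij by (simp add: mat_adjoint_index scalar_prod_def)
  also have "\<dots> = (mat_adjoint B * mat_adjoint A) $$ (i, j)"
    using assms ij by (simp add: mat_adjoint_index scalar_prod_def mult.commute)
  finally show "mat_adjoint (A * B) $$ (i, j) = (mat_adjoint B * mat_adjoint A) $$ (i, j)" .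
qed (use assms in simp_all)

lemma mat_adjoint_smult:
  fixes A :: "complex mat"
  shows "mat_adjoint (c \<cdot>\<^sub>m A) = cnj c \<cdot>\<^sub>m mat_adjoint A"
  by (rule eq_matI) (simp_all add: mat_adjoint_index)

lemma smult_smult_mat: "a \<cdot>\<^sub>m (b \<cdot>\<^sub>m A) = (a * b :: 'a :: semigroup_mult) \<cdot>\<^sub>m A"
  by (rule eq_matI) (simp_all add: mult.assoc)

lemma one_smult_mat [simp]: "(1 :: 'a :: monoid_mult) \<cdot>\<^sub>m A = A"
  by (rule eq_matI) simp_all

lemma mult_square_carrier:
  "A \<in> carrier_mat D D \<Longrightarrow> B \<in> carrier_mat D D \<Longrightarrow> A * B \<in> carrier_mat D D"
  by (rule mult_carrier_mat)

text \<open>Matrix laws specialised to square matrices of one size: with all dimensions identified,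
  the simplifier can discharge their carrier premises.\<close>

lemmas square_mat_simps =
  mult_square_carrier
  assoc_mult_mat[where n\<^sub>1 = D and n\<^sub>2 = D and n\<^sub>3 = D and n\<^sub>4 = D]
  mult_smult_assoc_mat[where nr = D and n = D and nc = D]
  mult_smult_distrib[where nr = D and n = D and nc = D]
  mult_add_distrib_mat[where nr = D and n = D and nc = D]
  add_mult_distrib_mat[where nr = D and n = D and nc = D]
  for D

text \<open>Errors are handled through the superoperator they induce rather than as operators,
  because the signs from reordering Pauli factors disappear there.\<close>

definition conj_map :: "complex mat \<Rightarrow> complex mat \<Rightarrow> complex mat" where
  "conj_map A X = A * X * mat_adjoint A"

lemma conj_map_carrier:
  "A \<in> carrier_mat D D \<Longrightarrow> X \<in> carrier_mat D D \<Longrightarrow> conj_map A X \<in> carrier_mat D D"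
  unfolding conj_map_def by (intro mult_carrier_mat mat_adjoint_carrier)

lemma conj_map_mult:
  assumes "A \<in> carrier_mat D D" "B \<in> carrier_mat D D" "X \<in> carrier_mat D D"
  shows "conj_map (A * B) X = conj_map A (conj_map B X)"
proof -
  have "mat_adjoint A \<in> carrier_mat D D" "mat_adjoint B \<in> carrier_mat D D"
    using assms by (auto intro: mat_adjoint_carrier)
  then show ?thesis
    using assms
    by (simp add: conj_map_def mat_adjoint_mult square_mat_simps[where D = D])
qed

lemma conj_map_one: "X \<in> carrier_mat D D \<Longrightarrow> conj_map (1\<^sub>m D) X = X"
  by (simp add: conj_map_def mat_adjoint_one)

text \<open>A phase cancels against its conjugate in the adjoint. This is why the order of the
  factors in a product of Pauli errors does not matter.\<close>

lemma conj_map_smult: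
  assumes "c * cnj c = 1" "A \<in> carrier_mat D D" "X \<in> carrier_mat D D"
  shows "conj_map (c \<cdot>\<^sub>m A) X = conj_map A X"
proof -
  have "mat_adjoint A \<in> carrier_mat D D" using assms by (auto intro: mat_adjoint_carrier)
  then have "conj_map (c \<cdot>\<^sub>m A) X = (c * cnj c) \<cdot>\<^sub>m conj_map A X"
    using assms(2,3) unfolding conj_map_def mat_adjoint_smult
    by (simp add: square_mat_simps[where D = D] smult_smult_mat mult.commute)
  then show ?thesis using assms(1) by (auto intro!: eq_matI)
qed

section \<open>Linear superoperators and finite sums\<close>

lemma linear_superop_carrier: "linear_superop D \<Phi> \<Longrightarrow> X \<in> carrier_mat D D \<Longrightarrow> \<Phi> X \<in> carrier_mat D D"
  and linear_superop_add: "linear_superop D \<Phi> \<Longrightarrow> X \<in> carrier_mat D D \<Longrightarrow> Y \<in> carrier_mat D D \<Longrightarrow>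
    \<Phi> (X + Y) = \<Phi> X + \<Phi> Y"
  and linear_superop_smult: "linear_superop D \<Phi> \<Longrightarrow> X \<in> carrier_mat D D \<Longrightarrow> \<Phi> (a \<cdot>\<^sub>m X) = a \<cdot>\<^sub>m \<Phi> X"
  unfolding linear_superop_def by auto

lemma linear_superop_conj_map:
  assumes "A \<in> carrier_mat D D"
  shows "linear_superop D (conj_map A)"
proof -
  have "mat_adjoint A \<in> carrier_mat D D" using assms by (auto intro: mat_adjoint_carrier)
  then show ?thesis
    using assms unfolding linear_superop_def conj_map_def
    by (simp add: square_mat_simps[where D = D])
qed

lemma mat_sum_carrier [simp]: "mat_sum D F A \<in> carrier_mat D D"
  by (simp add: mat_sum_def)

lemma mat_sum_index [simp]:
  "i < D \<Longrightarrow> j < D \<Longrightarrow> mat_sum D F A $$ (i, j) = (\<Sum>a\<in>A. F a $$ (i, j))"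
  by (simp add: mat_sum_def)

lemma mat_sum_dim [simp]: "dim_row (mat_sum D F A) = D" "dim_col (mat_sum D F A) = D"
  by (simp_all add: mat_sum_def)

lemma linear_superop_mat_sum:
  assumes \<Phi>: "linear_superop D \<Phi>" and "finite A" and F: "\<And>a. a \<in> A \<Longrightarrow> F a \<in> carrier_mat D D"
  shows "\<Phi> (mat_sum D F A) = mat_sum D (\<lambda>a. \<Phi> (F a)) A"
  using assms(2,3)
proof (induction A)
  case empty
  \<comment> \<open>The value at the zero matrix comes from homogeneity with scalar 0.\<close>
  have "mat_sum D F {} = 0 \<cdot>\<^sub>m mat_sum D F {}" by (rule eq_matI) simp_all
  then have "\<Phi> (mat_sum D F {}) = \<Phi> (0 \<cdot>\<^sub>m mat_sum D F {})" by simp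
  also have "\<dots> = 0 \<cdot>\<^sub>m \<Phi> (mat_sum D F {})" by (rule linear_superop_smult[OF \<Phi> mat_sum_carrier])
  also have "\<dots> = mat_sum D (\<lambda>a. \<Phi> (F a)) {}"
    using linear_superop_carrier[OF \<Phi> mat_sum_carrier, of F "{}"] by (intro eq_matI) simp_all
  finally show ?case .
next
  case (insert a A)
  have Fa: "F a \<in> carrier_mat D D" by (rule insert.prems) simp
  have "mat_sum D F (insert a A) = F a + mat_sum D F A"
    using insert.hyps Fa by (intro eq_matI) simp_all
  then have "\<Phi> (mat_sum D F (insert a A)) = \<Phi> (F a + mat_sum D F A)" by simp
  also have "\<dots> = \<Phi> (F a) + \<Phi> (mat_sum D F A)"
    by (rule linear_superop_add[OF \<Phi> Fa mat_sum_carrier])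
  also have "\<Phi> (mat_sum D F A) = mat_sum D (\<lambda>a. \<Phi> (F a)) A"
    by (intro insert.IH insert.prems) simp
  also have "\<Phi> (F a) + mat_sum D (\<lambda>a. \<Phi> (F a)) A = mat_sum D (\<lambda>a. \<Phi> (F a)) (insert a A)"
    using insert.hyps linear_superop_carrier[OF \<Phi> Fa] by (intro eq_matI) simp_all
  finally show ?case .
qed

section \<open>Random walk of the error weight\<close>

lemma pauli_noiseD:
  assumes "pauli_noise n N E" "\<mu> \<in> {1..N}"
  shows "E \<mu> \<in> carrier_mat (2 ^ n) (2 ^ n)" "E \<mu> * E \<mu> = 1\<^sub>m (2 ^ n)" "mat_adjoint (E \<mu>) = E \<mu>"
proof -
  obtain ps where "length ps = n" "E \<mu> = pauli_string ps"
    using assms unfolding pauli_noise_def by blast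
  then show "E \<mu> \<in> carrier_mat (2 ^ n) (2 ^ n)" "E \<mu> * E \<mu> = 1\<^sub>m (2 ^ n)" "mat_adjoint (E \<mu>) = E \<mu>"
    using pauli_string_carrier pauli_string_square pauli_string_adjoint by metis+
qed

lemma pauli_noise_commute:
  assumes "pauli_noise n N E" "\<mu> \<in> {1..N}" "\<nu> \<in> {1..N}"
  shows "\<exists>c\<in>{1, -1}. E \<mu> * E \<nu> = c \<cdot>\<^sub>m (E \<nu> * E \<mu>)"
proof -
  from assms obtain ps qs where "length ps = n" "E \<mu> = pauli_string ps"
    "length qs = n" "E \<nu> = pauli_string qs"
    unfolding pauli_noise_def by blast
  then show ?thesis using pauli_string_commute[of ps qs] by simp
qed

lemma foldr_mult_carrier:
  assumes "\<And>\<mu>. \<mu> \<in> set xs \<Longrightarrow> E \<mu> \<in> carrier_mat D D"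
  shows "foldr (\<lambda>\<mu> A. E \<mu> * A) xs (1\<^sub>m D) \<in> carrier_mat D D"
  using assms
proof (induction xs)
  case (Cons x xs)
  have "foldr (\<lambda>\<mu> A. E \<mu> * A) xs (1\<^sub>m D) \<in> carrier_mat D D"
    by (rule Cons.IH) (simp add: Cons.prems)
  moreover have "E x \<in> carrier_mat D D" by (simp add: Cons.prems)
  ultimately show ?case by simp
qed simp

lemma finite_atLeastAtMost_subset: "S \<subseteq> {1..N} \<Longrightarrow> finite (S :: nat set)"
  by (rule finite_subset[OF _ finite_atLeastAtMost])

lemma error_product_carrier:
  assumes "pauli_noise n N E" "S \<subseteq> {1..N}"
  shows "error_product n E S \<in> carrier_mat (2 ^ n) (2 ^ n)"
  unfolding error_product_def
  by (rule foldr_mult_carrier)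
    (use assms finite_atLeastAtMost_subset[OF assms(2)] in \<open>auto intro: pauli_noiseD(1)\<close>)

text \<open>\<open>error_product\<close> multiplies in increasing order of the indices, so enlarging
  the error set amounts to \<open>insort\<close>. Bringing the new factor to the front past the
  smaller indices costs one sign each.\<close>

lemma foldr_mult_insort:
  assumes E: "pauli_noise n N E" and "\<mu> \<in> {1..N}" "set xs \<subseteq> {1..N}"
  shows "\<exists>c\<in>{1, -1}. foldr (\<lambda>\<mu> A. E \<mu> * A) (insort \<mu> xs) (1\<^sub>m (2 ^ n))
    = c \<cdot>\<^sub>m (E \<mu> * foldr (\<lambda>\<mu> A. E \<mu> * A) xs (1\<^sub>m (2 ^ n)))"
  using assms(3)
proof (induction xs)
  case Nil
  show ?case by (intro bexI[of _ 1]) simp_all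
next
  case (Cons x xs)
  let ?P = "\<lambda>xs. foldr (\<lambda>\<mu> A. E \<mu> * A) xs (1\<^sub>m (2 ^ n))"
  let ?D = "2 ^ n"
  show ?case
  proof (cases "\<mu> \<le> x")
    case True
    then show ?thesis by (intro bexI[of _ 1]) simp_all
  next
    case False
    have x: "x \<in> {1..N}" and xs: "set xs \<subseteq> {1..N}" using Cons.prems by auto
    note cE = pauli_noiseD(1)[OF E x] pauli_noiseD(1)[OF E \<open>\<mu> \<in> {1..N}\<close>]
    have P: "?P xs \<in> carrier_mat ?D ?D"
      by (rule foldr_mult_carrier) (use xs in \<open>auto intro: pauli_noiseD(1)[OF E]\<close>)
    from Cons.IH[OF xs] obtain c where c: "c \<in> {1, -1}" "?P (insort \<mu> xs) = c \<cdot>\<^sub>m (E \<mu> * ?P xs)"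
      by (rule bexE)
    from pauli_noise_commute[OF E x \<open>\<mu> \<in> {1..N}\<close>]
    obtain e where e: "e \<in> {1, -1}" "E x * E \<mu> = e \<cdot>\<^sub>m (E \<mu> * E x)" by (rule bexE)
    have "?P (insort \<mu> (x # xs)) = E x * (c \<cdot>\<^sub>m (E \<mu> * ?P xs))"
      using False c(2) by simp
    also have "\<dots> = c \<cdot>\<^sub>m ((E x * E \<mu>) * ?P xs)"
      using cE P by (simp add: square_mat_simps[where D = ?D])
    also have "\<dots> = c \<cdot>\<^sub>m (e \<cdot>\<^sub>m ((E \<mu> * E x) * ?P xs))"
      unfolding e(2) using cE P by (simp add: square_mat_simps[where D = ?D])
    also have "\<dots> = (c * e) \<cdot>\<^sub>m (E \<mu> * ?P (x # xs))"
      using cE P by (simp add: smult_smult_mat square_mat_simps[where D = ?D])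
    finally show ?thesis using c(1) e(1) by (intro bexI[of _ "c * e"]) auto
  qed
qed

text \<open>The product for the larger set differs from \<open>E \<mu>\<close> times the product for
  \<open>S\<close> by a sign, which conjugation cancels.\<close>

lemma conj_map_error_product_insert:
  assumes E: "pauli_noise n N E" and \<mu>: "\<mu> \<in> {1..N}" and S: "S \<subseteq> {1..N}" and "\<mu> \<notin> S"
    and X: "X \<in> carrier_mat (2 ^ n) (2 ^ n)"
  shows "conj_map (error_product n E (insert \<mu> S)) X
    = conj_map (E \<mu>) (conj_map (error_product n E S) X)"
proof -
  have fin: "finite S" by (rule finite_atLeastAtMost_subset[OF S])
  have "set (sorted_list_of_set S) \<subseteq> {1..N}" using S fin by simp
  from foldr_mult_insort[OF E \<mu> this]
  have "\<exists>c\<in>{1, -1}. error_product n E (insert \<mu> S) = c \<cdot>\<^sub>m (E \<mu> * error_product n E S)"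
    using \<open>\<mu> \<notin> S\<close> fin unfolding error_product_def by simp
  then obtain c where c: "c \<in> {1, -1}"
    "error_product n E (insert \<mu> S) = c \<cdot>\<^sub>m (E \<mu> * error_product n E S)"
    by (rule bexE)
  note cE = pauli_noiseD(1)[OF E \<mu>] error_product_carrier[OF E S]
  have "c * cnj c = 1" using c(1) by auto
  then show ?thesis
    unfolding c(2) using conj_map_mult[OF cE X] conj_map_smult[OF _ mult_carrier_mat[OF cE] X] by metis
qed

text \<open>The factor \<open>E \<mu>\<close> can be split off from the product for
  \<open>S\<close>; it then meets the further \<open>E \<mu>\<close>, and the two square to the
  identity.\<close>

lemma conj_map_error_product_remove:
  assumes E: "pauli_noise n N E" and \<mu>: "\<mu> \<in> {1..N}" and S: "S \<subseteq> {1..N}" and "\<mu> \<in> S"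
    and X: "X \<in> carrier_mat (2 ^ n) (2 ^ n)"
  shows "conj_map (E \<mu>) (conj_map (error_product n E S) X)
    = conj_map (error_product n E (S - {\<mu>})) X"
proof -
  note cE = pauli_noiseD(1)[OF E \<mu>]
  have S': "S - {\<mu>} \<subseteq> {1..N}" using S by auto
  let ?Y = "conj_map (error_product n E (S - {\<mu>})) X"
  have Y: "?Y \<in> carrier_mat (2 ^ n) (2 ^ n)"
    by (rule conj_map_carrier[OF error_product_carrier[OF E S'] X])
  have "conj_map (error_product n E S) X = conj_map (E \<mu>) ?Y"
    using conj_map_error_product_insert[OF E \<mu> S' _ X] \<open>\<mu> \<in> S\<close> by (simp add: insert_absorb)
  then have "conj_map (E \<mu>) (conj_map (error_product n E S) X) = conj_map (E \<mu> * E \<mu>) ?Y"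
    using conj_map_mult[OF cE cE Y] by simp
  also have "\<dots> = ?Y"
    unfolding pauli_noiseD(2)[OF E \<mu>] by (rule conj_map_one[OF Y])
  finally show ?thesis .
qed

section \<open>Double counting of error sets of fixed size\<close>

lemma finite_error_subsets [simp]: "finite (error_subsets N k)"
  unfolding error_subsets_def by simp

lemma card_error_subsets: "card (error_subsets N k) = N choose k"
  unfolding error_subsets_def using n_subsets[of "{1..N}" k] by simp

lemma error_subsets_zero [simp]: "error_subsets N 0 = {{}}"
  unfolding error_subsets_def by (auto dest: finite_atLeastAtMost_subset simp: card_eq_0_iff)

text \<open>Pairs of a set \<open>S\<close> and an index outside it correspond to pairs of a larger
  set \<open>T\<close> and an index inside it. Letting \<open>f\<close> see both sets covers
  insertions and deletions at once: a summand depending on \<open>T\<close> alone counts the former,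
  one depending on \<open>S\<close> alone the latter.\<close>

lemma sum_error_subsets_Suc:
  fixes f :: "nat set \<Rightarrow> nat set \<Rightarrow> 'a :: comm_monoid_add"
  shows "(\<Sum>S\<in>error_subsets N k. \<Sum>\<mu>\<in>{1..N} - S. f S (insert \<mu> S)) =
    (\<Sum>T\<in>error_subsets N (Suc k). \<Sum>\<mu>\<in>T. f (T - {\<mu>}) T)"
proof -
  have fin: "finite S" if "S \<in> error_subsets N m" for S m
    using that finite_atLeastAtMost_subset unfolding error_subsets_def by blast
  have ins: "insert \<mu> S \<in> error_subsets N (Suc k)"
    if "S \<in> error_subsets N k" "\<mu> \<in> {1..N}" "\<mu> \<notin> S" for S \<mu>
    using that fin[OF that(1)] unfolding error_subsets_def by simp
  have del: "T - {\<mu>} \<in> error_subsets N k" "\<mu> \<in> {1..N}"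
    if "T \<in> error_subsets N (Suc k)" "\<mu> \<in> T" for T \<mu>
    using that fin[OF that(1)] unfolding error_subsets_def by (auto simp: card_Diff_singleton)
  have "(\<Sum>S\<in>error_subsets N k. \<Sum>\<mu>\<in>{1..N} - S. f S (insert \<mu> S)) =
      (\<Sum>(S, \<mu>)\<in>(SIGMA S:error_subsets N k. {1..N} - S). f S (insert \<mu> S))"
    by (rule sum.Sigma) auto
  also have "\<dots> = (\<Sum>(T, \<mu>)\<in>(SIGMA T:error_subsets N (Suc k). T). f (T - {\<mu>}) T)"
    by (rule sum.reindex_bij_witness[where i = "\<lambda>(T, \<mu>). (T - {\<mu>}, \<mu>)" and j = "\<lambda>(S, \<mu>). (insert \<mu> S, \<mu>)"])
      (auto simp: ins insert_absorb dest: del)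
  also have "\<dots> = (\<Sum>T\<in>error_subsets N (Suc k). \<Sum>\<mu>\<in>T. f (T - {\<mu>}) T)"
    by (rule sum.Sigma[symmetric]) (simp_all add: fin)
  finally show ?thesis .
qed

text \<open>A set of size \<open>k + 1\<close> arises by insertion from \<open>k + 1\<close> sets of
  size \<open>k\<close>, and a set of size \<open>k - 1\<close> by deletion from
  \<open>N - (k - 1)\<close> of them. The case distinction guards the truncated
  \<open>k - 1\<close>.\<close>

lemma sum_flip_error_subsets:
  fixes w :: "nat set \<Rightarrow> complex"
  assumes "k \<le> N"
  shows "(\<Sum>\<mu>\<in>{1..N}. \<Sum>S\<in>error_subsets N k. w (if \<mu> \<in> S then S - {\<mu>} else insert \<mu> S)) =
    of_nat (Suc k) * (\<Sum>T\<in>error_subsets N (Suc k). w T) +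
    (if k = 0 then 0 else of_nat (N - (k - 1)) * (\<Sum>T\<in>error_subsets N (k - 1). w T))"
proof -
  let ?g = "\<lambda>S \<mu>. w (if \<mu> \<in> S then S - {\<mu>} else insert \<mu> S)"
  have sub: "S \<subseteq> {1..N}" "card S = m" if "S \<in> error_subsets N m" for S m
    using that unfolding error_subsets_def by auto
  have "(\<Sum>\<mu>\<in>{1..N}. \<Sum>S\<in>error_subsets N k. ?g S \<mu>) =
      (\<Sum>S\<in>error_subsets N k. \<Sum>\<mu>\<in>{1..N}. ?g S \<mu>)"
    by (rule sum.swap)
  also have "\<dots> = (\<Sum>S\<in>error_subsets N k. (\<Sum>\<mu>\<in>{1..N} - S. ?g S \<mu>) + (\<Sum>\<mu>\<in>S. ?g S \<mu>))"
    by (intro sum.cong refl sum.subset_diff sub) simp_all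
  also have "\<dots> = (\<Sum>S\<in>error_subsets N k. (\<Sum>\<mu>\<in>{1..N} - S. w (insert \<mu> S))) +
      (\<Sum>S\<in>error_subsets N k. (\<Sum>\<mu>\<in>S. w (S - {\<mu>})))"
    by (simp add: sum.distrib)
  also have "(\<Sum>S\<in>error_subsets N k. (\<Sum>\<mu>\<in>{1..N} - S. w (insert \<mu> S))) =
      of_nat (Suc k) * (\<Sum>T\<in>error_subsets N (Suc k). w T)"
    unfolding sum_error_subsets_Suc[of "\<lambda>S T. w T"] by (simp add: sub(2) sum_distrib_left)
  also have "(\<Sum>S\<in>error_subsets N k. (\<Sum>\<mu>\<in>S. w (S - {\<mu>}))) =
      (if k = 0 then 0 else of_nat (N - (k - 1)) * (\<Sum>T\<in>error_subsets N (k - 1). w T))"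
  proof (cases k)
    case 0
    then show ?thesis by simp
  next
    case (Suc m)
    have "card ({1..N} - S) = N - m" if "S \<in> error_subsets N m" for S
      using sub[OF that] by (simp add: card_Diff_subset finite_atLeastAtMost_subset)
    then show ?thesis
      unfolding Suc sum_error_subsets_Suc[of "\<lambda>S T. w S", symmetric]
      by (simp add: sum_distrib_left)
  qed
  finally show ?thesis .
qed

section \<open>One error applied to the average over errors of given weight\<close>

lemma weight_channel_carrier [simp]: "weight_channel n N E k X \<in> carrier_mat (2 ^ n) (2 ^ n)"
  by (simp add: weight_channel_def)

lemma weight_channel_zero:
  assumes "X \<in> carrier_mat (2 ^ n) (2 ^ n)"
  shows "weight_channel n N E 0 X = X"
proof -
  show ?thesis
    unfolding weight_channel_def using assms
    by (intro eq_matI) (simp_all add: error_product_def mat_adjoint_one)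
qed

text \<open>Meant for the binomial identity
  \<open>(k + 1) * (N choose (k + 1)) = (N - k) * (N choose k)\<close>: it trades the normalisation
  for one weight against that for the neighbouring weight.\<close>

lemma frac_rearrange:
  fixes a b x y w :: "'a :: field"
  assumes "a * x = b * y" "x \<noteq> 0" "y \<noteq> 0"
  shows "a * w / y = b * (w / x)"
proof -
  have "a * w * x = b * w * y" using assms(1) by (metis mult.assoc mult.commute)
  then show ?thesis using assms(2,3) by (simp add: frac_eq_eq)
qed

text \<open>Pauli strings commute or anticommute and square to the identity, so a further error \<open>E \<mu>\<close>
  toggles the membership of \<open>\<mu>\<close> in the error set.\<close>

lemma sum_conj_map_weight_channel:
  assumes E: "pauli_noise n N E" and "k \<le> N" and X: "X \<in> carrier_mat (2 ^ n) (2 ^ n)"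
  shows "mat_sum (2 ^ n) (\<lambda>\<mu>. conj_map (E \<mu>) (weight_channel n N E k X)) {1..N} =
    of_nat k \<cdot>\<^sub>m weight_channel n N E (k - 1) X + of_nat (N - k) \<cdot>\<^sub>m weight_channel n N E (Suc k) X"
    (is "?L = ?R")
proof (rule eq_matI)
  let ?D = "2 ^ n :: nat"
  fix i j assume "i < dim_row ?R" "j < dim_col ?R"
  then have ij: "i < ?D" "j < ?D" by (simp_all add: weight_channel_def)
  define w where "w S = conj_map (error_product n E S) X $$ (i, j)" for S
  define W where "W m = (\<Sum>S\<in>error_subsets N m. w S)" for m
  have wc: "weight_channel n N E m X $$ (i, j) = W m / of_nat (N choose m)" for m
    using ij unfolding weight_channel_def W_def w_def conj_map_def
    by (simp add: card_error_subsets)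
  have sub: "S \<subseteq> {1..N}" if "S \<in> error_subsets N m" for S m
    using that unfolding error_subsets_def by auto
  have cS: "conj_map (error_product n E S) X \<in> carrier_mat ?D ?D" if "S \<in> error_subsets N k" for S
    by (rule conj_map_carrier[OF error_product_carrier[OF E sub[OF that]] X])
  have "conj_map (E \<mu>) (weight_channel n N E k X) $$ (i, j) =
      (\<Sum>S\<in>error_subsets N k. w (if \<mu> \<in> S then S - {\<mu>} else insert \<mu> S)) / of_nat (N choose k)"
    if \<mu>: "\<mu> \<in> {1..N}" for \<mu>
  proof -
    note lin = linear_superop_conj_map[OF pauli_noiseD(1)[OF E \<mu>]]
    let ?M = "mat_sum ?D (\<lambda>S. conj_map (error_product n E S) X) (error_subsets N k)"
    have "conj_map (E \<mu>) (weight_channel n N E k X) =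
        conj_map (E \<mu>) ((1 / of_nat (card (error_subsets N k))) \<cdot>\<^sub>m ?M)"
      unfolding weight_channel_def conj_map_def ..
    also have "\<dots> = (1 / of_nat (card (error_subsets N k))) \<cdot>\<^sub>m conj_map (E \<mu>) ?M"
      by (rule linear_superop_smult[OF lin mat_sum_carrier])
    also have "conj_map (E \<mu>) ?M = mat_sum ?D (\<lambda>S. conj_map (E \<mu>) (conj_map (error_product n E S) X))
        (error_subsets N k)"
      by (rule linear_superop_mat_sum[OF lin finite_error_subsets cS])
    finally have "conj_map (E \<mu>) (weight_channel n N E k X) $$ (i, j) =
        (\<Sum>S\<in>error_subsets N k. conj_map (E \<mu>) (conj_map (error_product n E S) X) $$ (i, j)) /
        of_nat (N choose k)"
      using ij by (simp add: card_error_subsets)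
    also have "(\<Sum>S\<in>error_subsets N k. conj_map (E \<mu>) (conj_map (error_product n E S) X) $$ (i, j)) =
        (\<Sum>S\<in>error_subsets N k. w (if \<mu> \<in> S then S - {\<mu>} else insert \<mu> S))"
      unfolding w_def using conj_map_error_product_insert[OF E \<mu> sub _ X]
        conj_map_error_product_remove[OF E \<mu> sub _ X]
      by (intro sum.cong) auto
    finally show ?thesis .
  qed
  then have "?L $$ (i, j) = (\<Sum>\<mu>\<in>{1..N}. \<Sum>S\<in>error_subsets N k.
      w (if \<mu> \<in> S then S - {\<mu>} else insert \<mu> S)) / of_nat (N choose k)"
    using ij by (simp add: sum_divide_distrib)
  also have "\<dots> = of_nat (Suc k) * W (Suc k) / of_nat (N choose k) +
      (if k = 0 then 0 else of_nat (N - (k - 1)) * W (k - 1) / of_nat (N choose k))"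
    unfolding sum_flip_error_subsets[OF \<open>k \<le> N\<close>] W_def by (simp add: add_divide_distrib)
  also have "of_nat (Suc k) * W (Suc k) / of_nat (N choose k) =
      of_nat (N - k) * (W (Suc k) / of_nat (N choose Suc k))"
  proof (cases "k = N")
    \<comment> \<open>There are no error sets of size \<open>N + 1\<close>, so
      \<open>W (Suc k)\<close> is an empty sum, and the factor \<open>N - k\<close> on the other
      side is zero as well.\<close>
    case True
    have "card (error_subsets N (Suc N)) = 0" by (simp add: card_error_subsets)
    then have "error_subsets N (Suc N) = {}" by (metis card_0_eq finite_error_subsets)
    then show ?thesis using True by (simp add: W_def)
  next
    case False
    have "Suc k * (N choose Suc k) = (N - k) * (N choose k)"
      by (simp only: binomial_absorption binomial_absorb_comp)
    from arg_cong[OF this, of "of_nat :: nat \<Rightarrow> complex"]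
    have "of_nat (Suc k) * of_nat (N choose Suc k) = (of_nat (N - k) * of_nat (N choose k) :: complex)"
      by (simp only: of_nat_mult)
    moreover have "of_nat (N choose Suc k) \<noteq> (0 :: complex)" "of_nat (N choose k) \<noteq> (0 :: complex)"
      using False \<open>k \<le> N\<close> by auto
    ultimately show ?thesis by (rule frac_rearrange)
  qed
  \<comment> \<open>At \<open>k = 0\<close> the truncated index \<open>k - 1 = 0\<close> is
    harmless, because it comes with the factor \<open>k\<close>.\<close>
  also have "(if k = 0 then 0 else of_nat (N - (k - 1)) * W (k - 1) / of_nat (N choose k)) =
      of_nat k * (W (k - 1) / of_nat (N choose (k - 1)))"
  proof (cases k)
    case (Suc m)
    have "Suc m * (N choose Suc m) = (N - m) * (N choose m)"
      by (simp only: binomial_absorption binomial_absorb_comp)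
    from arg_cong[OF this, of "of_nat :: nat \<Rightarrow> complex"]
    have "of_nat (Suc m) * of_nat (N choose Suc m) = (of_nat (N - m) * of_nat (N choose m) :: complex)"
      by (simp only: of_nat_mult)
    moreover have "of_nat (N choose Suc m) \<noteq> (0 :: complex)" "of_nat (N choose m) \<noteq> (0 :: complex)"
      using Suc \<open>k \<le> N\<close> by auto
    ultimately have "of_nat (Suc m) * (W m / of_nat (N choose m)) =
        of_nat (N - m) * W m / of_nat (N choose Suc m)"
      by (intro frac_rearrange[symmetric]) simp_all
    then show ?thesis using Suc by simp
  qed simp
  also have "of_nat (N - k) * (W (Suc k) / of_nat (N choose Suc k)) +
      of_nat k * (W (k - 1) / of_nat (N choose (k - 1))) = ?R $$ (i, j)"
    using ij carrier_matD[OF weight_channel_carrier] by (simp add: wc)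
  finally show "?L $$ (i, j) = ?R $$ (i, j)" .
qed (simp_all add: weight_channel_def)

section \<open>Exponential of a shifted superoperator\<close>

definition linear_functional :: "nat \<Rightarrow> (complex mat \<Rightarrow> complex) \<Rightarrow> bool" where
  "linear_functional D g \<longleftrightarrow>
     (\<forall>X\<in>carrier_mat D D. \<forall>Y\<in>carrier_mat D D. g (X + Y) = g X + g Y) \<and>
     (\<forall>X\<in>carrier_mat D D. \<forall>a. g (a \<cdot>\<^sub>m X) = a * g X)"

lemma linear_functional_add:
    "linear_functional D g \<Longrightarrow> X \<in> carrier_mat D D \<Longrightarrow> Y \<in> carrier_mat D D \<Longrightarrow> g (X + Y) = g X + g Y"
  and linear_functional_smult:
    "linear_functional D g \<Longrightarrow> X \<in> carrier_mat D D \<Longrightarrow> g (a \<cdot>\<^sub>m X) = a * g X"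
  unfolding linear_functional_def by auto

text \<open>The coefficients are the values of \<open>g\<close> on the matrix units. Being a finite
  combination of entries is what makes norm bounds and termwise summation available for
  \<open>g\<close>.\<close>

lemma linear_functional_expansion:
  assumes g: "linear_functional D g"
  obtains c where
    "\<And>X. X \<in> carrier_mat D D \<Longrightarrow> g X = (\<Sum>p\<in>{..<D} \<times> {..<D}. c p * X $$ p)"
proof
  fix X :: "complex mat" assume X: "X \<in> carrier_mat D D"
  define U where "U p = mat D D (\<lambda>q. if q = p then 1 else 0 :: complex)" for p
  \<comment> \<open>\<open>M A\<close> keeps the entries of \<open>X\<close> at positions in
    \<open>A\<close> only; the induction adds one position at a time.\<close>
  define M where "M A = mat D D (\<lambda>q. if q \<in> A then X $$ q else 0)" for A
  have MC: "M A \<in> carrier_mat D D" "U p \<in> carrier_mat D D" for A p by (simp_all add: M_def U_def)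
  have "g (M A) = (\<Sum>p\<in>A. g (U p) * X $$ p)" if "finite A" for A
    using that
  proof (induction A)
    case empty
    have "M {} = 0 \<cdot>\<^sub>m M {}" by (rule eq_matI) (simp_all add: M_def)
    then have "g (M {}) = g (0 \<cdot>\<^sub>m M {})" by (rule arg_cong)
    also have "\<dots> = 0 * g (M {})" by (rule linear_functional_smult[OF g MC(1)])
    finally show ?case by simp
  next
    case (insert p A)
    have "M (insert p A) = X $$ p \<cdot>\<^sub>m U p + M A"
      using insert.hyps by (intro eq_matI) (auto simp: M_def U_def)
    then have "g (M (insert p A)) = X $$ p * g (U p) + g (M A)"
      using linear_functional_add[OF g smult_carrier_mat[OF MC(2)] MC(1)]
        linear_functional_smult[OF g MC(2)] by simp
    then show ?case using insert by (simp add: mult.commute)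
  qed
  moreover have "M ({..<D} \<times> {..<D}) = X" using X by (intro eq_matI) (auto simp: M_def)
  ultimately show "g X = (\<Sum>p\<in>{..<D} \<times> {..<D}. g (mat D D (\<lambda>q. if q = p then 1 else 0)) * X $$ p)"
    by (metis (no_types, lifting) U_def finite_SigmaI finite_lessThan sum.cong)
qed

lemma linear_functional_entry:
  assumes "linear_superop D \<Phi>" "i < D" "j < D"
  shows "linear_functional D (\<lambda>X. \<Phi> X $$ (i, j))"
  unfolding linear_functional_def
proof (intro conjI ballI allI)
  fix X Y :: "complex mat" assume XY: "X \<in> carrier_mat D D" "Y \<in> carrier_mat D D"
  show "\<Phi> (X + Y) $$ (i, j) = \<Phi> X $$ (i, j) + \<Phi> Y $$ (i, j)"
    using linear_superop_add[OF assms(1) XY] linear_superop_carrier[OF assms(1) XY(1)]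
      linear_superop_carrier[OF assms(1) XY(2)] assms(2,3) by simp
next
  fix X :: "complex mat" and a assume X: "X \<in> carrier_mat D D"
  show "\<Phi> (a \<cdot>\<^sub>m X) $$ (i, j) = a * \<Phi> X $$ (i, j)"
    using linear_superop_smult[OF assms(1) X] linear_superop_carrier[OF assms(1) X] assms(2,3) by simp
qed

section \<open>Boundedness and absolute convergence of the exponential series\<close>

lemma linear_superop_funpow:
  assumes "linear_superop D \<Phi>"
  shows "linear_superop D (\<Phi> ^^ m)"
proof (induction m)
  case 0
  show ?case by (simp add: linear_superop_def)
next
  case (Suc m)
  then show ?case using assms by (simp add: linear_superop_def)
qed

text \<open>The entrywise l1 norm, convenient because it bounds each single entry.\<close>

definition entry_norm :: "nat \<Rightarrow> complex mat \<Rightarrow> real" where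
  "entry_norm D X = (\<Sum>p\<in>{..<D} \<times> {..<D}. cmod (X $$ p))"

lemma cmod_entry_le: "i < D \<Longrightarrow> j < D \<Longrightarrow> cmod (X $$ (i, j)) \<le> entry_norm D X"
  unfolding entry_norm_def by (rule member_le_sum) auto

text \<open>Each entry of \<open>\<Phi> X\<close> is a linear functional of \<open>X\<close>, hence
  a combination of entries; \<open>B\<close> is the sum of the moduli of all coefficients.\<close>

lemma linear_superop_bounded:
  assumes \<Phi>: "linear_superop D \<Phi>"
  obtains B where "0 \<le> B" "\<And>X. X \<in> carrier_mat D D \<Longrightarrow> entry_norm D (\<Phi> X) \<le> B * entry_norm D X"
proof -
  let ?I = "{..<D} \<times> {..<D}"
  have "\<exists>c. \<forall>X\<in>carrier_mat D D. \<Phi> X $$ p = (\<Sum>q\<in>?I. c q * X $$ q)" if p: "p \<in> ?I" for p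
  proof -
    obtain i j where ij: "p = (i, j)" "i < D" "j < D" using p by auto
    from linear_functional_expansion[OF linear_functional_entry[OF \<Phi> ij(2,3)]] ij(1) show ?thesis
      by metis
  qed
  then obtain c where c: "\<And>p X. p \<in> ?I \<Longrightarrow> X \<in> carrier_mat D D \<Longrightarrow> \<Phi> X $$ p = (\<Sum>q\<in>?I. c p q * X $$ q)"
    by metis
  define B where "B = (\<Sum>p\<in>?I. \<Sum>q\<in>?I. cmod (c p q))"
  show ?thesis
  proof
    show "0 \<le> B" unfolding B_def by (intro sum_nonneg) auto
    fix X :: "complex mat" assume X: "X \<in> carrier_mat D D"
    have entry: "cmod (X $$ q) \<le> entry_norm D X" if "q \<in> ?I" for q
      using that by (auto intro: cmod_entry_le)
    have "entry_norm D (\<Phi> X) \<le> (\<Sum>p\<in>?I. \<Sum>q\<in>?I. cmod (c p q) * entry_norm D X)"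
      unfolding entry_norm_def[of D "\<Phi> X"]
    proof (rule sum_mono)
      fix p assume p: "p \<in> ?I"
      have "cmod (\<Phi> X $$ p) \<le> (\<Sum>q\<in>?I. cmod (c p q * X $$ q))"
        unfolding c[OF p X] by (rule norm_sum)
      also have "\<dots> \<le> (\<Sum>q\<in>?I. cmod (c p q) * entry_norm D X)"
        unfolding norm_mult by (intro sum_mono mult_left_mono entry) auto
      finally show "cmod (\<Phi> X $$ p) \<le> (\<Sum>q\<in>?I. cmod (c p q) * entry_norm D X)" .
    qed
    also have "\<dots> = B * entry_norm D X" unfolding B_def by (simp add: sum_distrib_right)
    finally show "entry_norm D (\<Phi> X) \<le> B * entry_norm D X" .
  qed
qed

text \<open>The powers of \<open>K\<close> grow at most geometrically, so the exponential series of
  \<open>\<bar>t\<bar> * B\<close> is a majorant. Absolute convergence is what the Cauchy product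
  below asks for.\<close>

lemma summable_superop_exp:
  assumes K: "linear_superop D K" and X: "X \<in> carrier_mat D D" and ij: "i < D" "j < D"
  shows "summable (\<lambda>m. norm (of_real (t ^ m / fact m) * (K ^^ m) X $$ (i, j)))"
proof -
  from linear_superop_bounded[OF K] obtain B where B: "0 \<le> B"
    "\<And>X. X \<in> carrier_mat D D \<Longrightarrow> entry_norm D (K X) \<le> B * entry_norm D X" by blast
  have "entry_norm D ((K ^^ m) X) \<le> B ^ m * entry_norm D X" for m
  proof (induction m)
    case (Suc m)
    have "entry_norm D ((K ^^ Suc m) X) \<le> B * entry_norm D ((K ^^ m) X)"
      using B(2)[OF linear_superop_carrier[OF linear_superop_funpow[OF K] X]] by simp
    also have "\<dots> \<le> B * (B ^ m * entry_norm D X)" by (rule mult_left_mono[OF Suc.IH B(1)])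
    finally show ?case by (simp add: mult.assoc)
  qed simp
  then have "cmod ((K ^^ m) X $$ (i, j)) \<le> B ^ m * entry_norm D X" for m
    using cmod_entry_le[OF ij] order_trans by blast
  then have "norm (of_real (t ^ m / fact m) * (K ^^ m) X $$ (i, j)) \<le>
      \<bar>t\<bar> ^ m / fact m * (B ^ m * entry_norm D X)" for m
    unfolding norm_mult by (intro mult_mono) (simp_all add: norm_divide norm_power power_abs)
  then have le: "norm (norm (of_real (t ^ m / fact m) * (K ^^ m) X $$ (i, j))) \<le>
      entry_norm D X * (inverse (fact m) * (\<bar>t\<bar> * B) ^ m)" for m
    by (simp add: field_simps power_mult_distrib)
  show ?thesis
    by (rule summable_comparison_test'[OF summable_mult[OF summable_exp[of "\<bar>t\<bar> * B"]] le])
qed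

text \<open>Pascal's rule under the sum. Here \<open>a j\<close> stands for an entry of the
  \<open>j\<close>-th power of \<open>K\<close> at \<open>X\<close>, and
  \<open>a (Suc j) + y * a j\<close> for the same entry after one more application of
  \<open>K + y\<close>.\<close>

lemma sum_binomial_step:
  fixes a :: "nat \<Rightarrow> 'a :: comm_ring_1"
  shows "(\<Sum>j\<le>k. of_nat (k choose j) * (a (Suc j) + y * a j) * y ^ (k - j)) =
    (\<Sum>j\<le>Suc k. of_nat (Suc k choose j) * a j * y ^ (Suc k - j))"
proof -
  have "(\<Sum>j\<le>Suc k. of_nat (Suc k choose j) * a j * y ^ (Suc k - j)) =
      a 0 * y ^ Suc k + (\<Sum>j\<le>k. of_nat (k choose j) * a (Suc j) * y ^ (k - j)) +
      (\<Sum>j\<le>k. of_nat (k choose Suc j) * a (Suc j) * y ^ (k - j))"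
    by (subst sum.atMost_Suc_shift) (simp add: sum.distrib algebra_simps)
  also have "a 0 * y ^ Suc k + (\<Sum>j\<le>k. of_nat (k choose j) * a (Suc j) * y ^ (k - j)) +
      (\<Sum>j\<le>k. of_nat (k choose Suc j) * a (Suc j) * y ^ (k - j)) =
      (\<Sum>j\<le>k. of_nat (k choose j) * a (Suc j) * y ^ (k - j)) +
      (\<Sum>j\<le>Suc k. of_nat (k choose j) * a j * y ^ (Suc k - j))"
    by (subst sum.atMost_Suc_shift[of "\<lambda>j. of_nat (k choose j) * a j * y ^ (Suc k - j)"]) simp
  \<comment> \<open>The top term drops out, since \<open>k choose Suc k\<close> is zero.\<close>
  also have "(\<Sum>j\<le>Suc k. of_nat (k choose j) * a j * y ^ (Suc k - j)) =
      (\<Sum>j\<le>k. of_nat (k choose j) * (y * a j) * y ^ (k - j))"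
    by (simp add: Suc_diff_le binomial_eq_0 algebra_simps)
  finally show ?thesis by (simp add: sum.distrib algebra_simps)
qed

text \<open>The binomial theorem for \<open>K\<close> and a multiple of the identity, which commutes
  with the linear map \<open>K\<close>.\<close>

lemma superop_funpow_shift:
  assumes K: "linear_superop D K"
    and L: "\<And>X. X \<in> carrier_mat D D \<Longrightarrow> L X = K X + y \<cdot>\<^sub>m X"
    and X: "X \<in> carrier_mat D D" and ij: "i < D" "j < D"
  shows "(L ^^ k) X $$ (i, j) = (\<Sum>l\<le>k. of_nat (k choose l) * (K ^^ l) X $$ (i, j) * y ^ (k - l))"
  using X
proof (induction k arbitrary: X)
  case (Suc k)
  note KX = linear_superop_carrier[OF K Suc.prems] and yX = smult_carrier_mat[OF Suc.prems, of y]
  have entry: "(K ^^ l) (L X) $$ (i, j) = (K ^^ Suc l) X $$ (i, j) + y * (K ^^ l) X $$ (i, j)" for l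
  proof -
    note Kl = linear_superop_funpow[OF K, of l]
    have "(K ^^ l) (L X) = (K ^^ l) (K X) + y \<cdot>\<^sub>m (K ^^ l) X"
      unfolding L[OF Suc.prems] linear_superop_add[OF Kl KX yX] linear_superop_smult[OF Kl Suc.prems] ..
    then show ?thesis
      using linear_superop_carrier[OF Kl KX] linear_superop_carrier[OF Kl Suc.prems] ij
      by (simp add: funpow_swap1)
  qed
  have LX: "L X \<in> carrier_mat D D" unfolding L[OF Suc.prems] using KX yX by simp
  \<comment> \<open>The innermost \<open>L\<close> is peeled off, so that the hypothesis applies at
    \<open>L X\<close> and the powers of \<open>K\<close> act on \<open>L X\<close> by
    linearity.\<close>
  have "(L ^^ Suc k) X $$ (i, j) = (L ^^ k) (L X) $$ (i, j)"
    by (simp only: funpow_Suc_right comp_apply)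
  also have "\<dots> = (\<Sum>l\<le>k. of_nat (k choose l) *
      ((K ^^ Suc l) X $$ (i, j) + y * (K ^^ l) X $$ (i, j)) * y ^ (k - l))"
    unfolding Suc.IH[OF LX] entry ..
  also have "\<dots> = (\<Sum>l\<le>Suc k. of_nat (Suc k choose l) * (K ^^ l) X $$ (i, j) * y ^ (Suc k - l))"
    by (rule sum_binomial_step)
  finally show ?case .
qed simp

text \<open>The scalar part of the generator contributes the factor \<open>exp (y * t)\<close>: the
  series for \<open>L\<close> is the Cauchy product of the series for \<open>K\<close> and the
  scalar exponential series.\<close>

lemma superop_exp_shift:
  assumes K: "linear_superop D K"
    and L: "\<And>X. X \<in> carrier_mat D D \<Longrightarrow> L X = K X + of_real y \<cdot>\<^sub>m X"
    and X: "X \<in> carrier_mat D D" and ij: "i < D" "j < D"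
  shows "superop_exp D L t X $$ (i, j) =
    (\<Sum>m. of_real (t ^ m / fact m) * (K ^^ m) X $$ (i, j)) * of_real (exp (y * t))"
proof -
  let ?a = "\<lambda>m. of_real (t ^ m / fact m) * (K ^^ m) X $$ (i, j)"
  let ?b = "\<lambda>m. (of_real (y * t) :: complex) ^ m /\<^sub>R fact m"
  have conv: "(\<Sum>l\<le>k. ?a l * ?b (k - l)) = of_real (t ^ k / fact k) * (L ^^ k) X $$ (i, j)" for k
  proof -
    have "?a l * ?b (k - l) =
        of_real (t ^ k / fact k) * (of_nat (k choose l) * (K ^^ l) X $$ (i, j) * of_real y ^ (k - l))"
      if "l \<le> k" for l
    proof -
      have "t ^ l * t ^ (k - l) = t ^ k" using that by (simp flip: power_add)
      then have pw: "complex_of_real t ^ l * of_real t ^ (k - l) = of_real t ^ k"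
        by (metis of_real_mult of_real_power)
      have "of_nat (k choose l) = (fact k / (fact l * fact (k - l)) :: complex)"
        by (rule binomial_fact[OF that])
      then show ?thesis
        by (simp add: scaleR_conv_of_real power_mult_distrib field_simps flip: pw)
    qed
    then have "(\<Sum>l\<le>k. ?a l * ?b (k - l)) = of_real (t ^ k / fact k) *
        (\<Sum>l\<le>k. of_nat (k choose l) * (K ^^ l) X $$ (i, j) * of_real y ^ (k - l))"
      unfolding sum_distrib_left by (intro sum.cong) auto
    also have "(\<Sum>l\<le>k. of_nat (k choose l) * (K ^^ l) X $$ (i, j) * of_real y ^ (k - l)) =
        (L ^^ k) X $$ (i, j)"
      by (rule superop_funpow_shift[OF K _ X ij, symmetric]) (rule L)
    finally show ?thesis .
  qed
  have "(\<lambda>k. \<Sum>l\<le>k. ?a l * ?b (k - l)) sums ((\<Sum>m. ?a m) * (\<Sum>m. ?b m))"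
    by (rule Cauchy_product_sums[OF summable_superop_exp[OF K X ij] summable_norm_exp])
  moreover have "(\<Sum>m. ?b m) = exp (of_real (y * t))"
    unfolding exp_def ..
  then have "(\<Sum>m. ?b m) = of_real (exp (y * t))"
    by (simp only: exp_of_real)
  ultimately show ?thesis
    unfolding conv superop_exp_def using ij by (simp add: sums_iff)
qed

text \<open>A finite combination of entries may be summed term by term. This expresses a fidelity at
  time \<open>t\<close> through its values after \<open>m\<close> applications of \<open>K\<close>,
  where lower bounds are available.\<close>

lemma linear_functional_superop_exp:
  assumes K: "linear_superop D K"
    and L: "\<And>X. X \<in> carrier_mat D D \<Longrightarrow> L X = K X + of_real y \<cdot>\<^sub>m X"
    and X: "X \<in> carrier_mat D D" and g: "linear_functional D g"
  shows "(\<lambda>m. of_real (t ^ m / fact m) * g ((K ^^ m) X)) sums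
    (g (superop_exp D L t X) * of_real (exp (- (y * t))))"
proof -
  from linear_functional_expansion[OF g] obtain c where
    c: "\<And>X. X \<in> carrier_mat D D \<Longrightarrow> g X = (\<Sum>p\<in>{..<D} \<times> {..<D}. c p * X $$ p)" by blast
  have entry: "(\<lambda>m. c p * (of_real (t ^ m / fact m) * (K ^^ m) X $$ p)) sums
      (c p * (superop_exp D L t X $$ p * of_real (exp (- (y * t)))))"
    if pI: "p \<in> {..<D} \<times> {..<D}" for p
  proof (rule sums_mult)
    obtain i j where p: "p = (i, j)" and ij: "i < D" "j < D" using pI by auto
    have shift: "superop_exp D L t X $$ (i, j) =
        (\<Sum>m. of_real (t ^ m / fact m) * (K ^^ m) X $$ (i, j)) * of_real (exp (y * t))"
      by (rule superop_exp_shift[OF K _ X ij]) (rule L)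
    have "complex_of_real (exp (y * t)) * of_real (exp (- (y * t))) = 1"
      by (simp flip: of_real_mult exp_add)
    then have "superop_exp D L t X $$ p * of_real (exp (- (y * t))) =
        (\<Sum>m. of_real (t ^ m / fact m) * (K ^^ m) X $$ p)"
      unfolding p shift by (simp only: mult.assoc mult_1_right)
    then show "(\<lambda>m. of_real (t ^ m / fact m) * (K ^^ m) X $$ p) sums
        (superop_exp D L t X $$ p * of_real (exp (- (y * t))))"
      using summable_sums[OF summable_norm_cancel[OF summable_superop_exp[OF K X ij]]] p by simp
  qed
  have "(\<lambda>m. \<Sum>p\<in>{..<D} \<times> {..<D}. c p * (of_real (t ^ m / fact m) * (K ^^ m) X $$ p)) sums
      (\<Sum>p\<in>{..<D} \<times> {..<D}. c p * (superop_exp D L t X $$ p * of_real (exp (- (y * t)))))"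
    by (rule sums_sum[OF entry])
  moreover have "superop_exp D L t X \<in> carrier_mat D D" by (simp add: superop_exp_def)
  ultimately show ?thesis
    using linear_superop_carrier[OF linear_superop_funpow[OF K] X]
    by (simp add: c sum_distrib_left sum_distrib_right mult_ac)
qed

section \<open>Positivity and fidelity\<close>

text \<open>For matching dimensions this is \<open>(A *\<^sub>v v) \<bullet>c v\<close> in
  coordinates, a form in which linearity in \<open>A\<close> is immediate.\<close>

definition quad_form :: "nat \<Rightarrow> complex mat \<Rightarrow> complex vec \<Rightarrow> complex" where
  "quad_form D A v = (\<Sum>i<D. \<Sum>j<D. A $$ (i, j) * v $ j * cnj (v $ i))"

lemma cscalar_prod_mult_mat_vec:
  assumes "A \<in> carrier_mat D D" "v \<in> carrier_vec D"
  shows "(A *\<^sub>v v) \<bullet>c v = quad_form D A v"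
  using assms
  by (simp add: quad_form_def scalar_prod_def sum_distrib_right atLeast0LessThan)

lemma psd_iff_quad_form:
  "psd D A \<longleftrightarrow> A \<in> carrier_mat D D \<and> (\<forall>v\<in>carrier_vec D. 0 \<le> quad_form D A v)"
  unfolding psd_def using cscalar_prod_mult_mat_vec by auto

lemma psd_carrier: "psd D A \<Longrightarrow> A \<in> carrier_mat D D"
  by (simp add: psd_def)

lemma quad_form_add:
  "A \<in> carrier_mat D D \<Longrightarrow> B \<in> carrier_mat D D \<Longrightarrow>
    quad_form D (A + B) v = quad_form D A v + quad_form D B v"
  unfolding quad_form_def sum.distrib[symmetric]
  by (intro sum.cong refl) (simp add: algebra_simps)

lemma quad_form_smult:
  "A \<in> carrier_mat D D \<Longrightarrow> quad_form D (a \<cdot>\<^sub>m A) v = a * quad_form D A v"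
  unfolding quad_form_def sum_distrib_left
  by (intro sum.cong refl) (simp add: mult.assoc)

lemma quad_form_mat_sum:
  "quad_form D (mat_sum D F A) v = (\<Sum>a\<in>A. quad_form D (F a) v)"
proof -
  have "(\<Sum>a\<in>A. quad_form D (F a) v) =
      (\<Sum>i<D. \<Sum>j<D. \<Sum>a\<in>A. F a $$ (i, j) * v $ j * cnj (v $ i))"
    unfolding quad_form_def by (subst sum.swap) (intro sum.cong refl sum.swap)
  then show ?thesis by (simp add: quad_form_def sum_distrib_right)
qed

lemma psd_add: "psd D A \<Longrightarrow> psd D B \<Longrightarrow> psd D (A + B)"
  unfolding psd_iff_quad_form by (simp add: quad_form_add)

lemma psd_smult: "psd D A \<Longrightarrow> 0 \<le> a \<Longrightarrow> psd D (a \<cdot>\<^sub>m A)"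
  unfolding psd_iff_quad_form by (simp add: quad_form_smult)

lemma psd_mat_sum: "(\<And>a. a \<in> A \<Longrightarrow> psd D (F a)) \<Longrightarrow> psd D (mat_sum D F A)"
  unfolding psd_iff_quad_form by (simp add: quad_form_mat_sum sum_nonneg)

text \<open>Moving \<open>A\<close> to the other side of the inner product turns the quadratic form
  at \<open>v\<close> into that of \<open>X\<close> at the vector obtained from \<open>v\<close> by
  the adjoint of \<open>A\<close>.\<close>

lemma psd_conj_map:
  assumes A: "A \<in> carrier_mat D D" and X: "psd D X"
  shows "psd D (conj_map A X)"
  unfolding psd_def
proof (intro conjI ballI)
  note XC = psd_carrier[OF X] and A' = mat_adjoint_carrier[OF A]
  show "conj_map A X \<in> carrier_mat D D" by (rule conj_map_carrier[OF A XC])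
  fix v :: "complex vec" assume v: "v \<in> carrier_vec D"
  let ?w = "mat_adjoint A *\<^sub>v v"
  have w: "?w \<in> carrier_vec D" by (rule mult_mat_vec_carrier[OF A' v])
  have adj: "(A *\<^sub>v u) \<bullet>c v = u \<bullet>c ?w" if u: "u \<in> carrier_vec D" for u
  proof -
    have "(A *\<^sub>v u) \<bullet>c v = (\<Sum>i\<in>{0..<D}. \<Sum>j\<in>{0..<D}. A $$ (i, j) * u $ j * cnj (v $ i))"
      using A u v by (simp add: scalar_prod_def sum_distrib_right)
    also have "\<dots> = (\<Sum>j\<in>{0..<D}. \<Sum>i\<in>{0..<D}. A $$ (i, j) * u $ j * cnj (v $ i))"
      by (rule sum.swap)
    also have "\<dots> = u \<bullet>c ?w"
      using A u v by (simp add: scalar_prod_def sum_distrib_left mat_adjoint_index mult_ac)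
    finally show ?thesis .
  qed
  have "conj_map A X *\<^sub>v v = A *\<^sub>v (X *\<^sub>v ?w)"
    unfolding conj_map_def
    using assoc_mult_mat_vec[OF mult_carrier_mat[OF A XC] A' v] assoc_mult_mat_vec[OF A XC w] by simp
  then have "(conj_map A X *\<^sub>v v) \<bullet>c v = (X *\<^sub>v ?w) \<bullet>c ?w"
    using adj[OF mult_mat_vec_carrier[OF XC w]] by simp
  then show "0 \<le> (conj_map A X *\<^sub>v v) \<bullet>c v" using X w unfolding psd_def by simp
qed

text \<open>With a one-dimensional ancilla the only block is \<open>X\<close> itself, and the
  ampliation is \<open>\<Phi>\<close>.\<close>

lemma completely_positive_psd:
  assumes cp: "completely_positive D \<Phi>" and \<Phi>: "linear_superop D \<Phi>" and X: "psd D X"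
  shows "psd D (\<Phi> X)"
proof -
  have XC: "X \<in> carrier_mat D D" by (rule psd_carrier[OF X])
  have "block D X 0 0 = X" using XC by (intro eq_matI) (simp_all add: block_def)
  then have "ampliation 1 D \<Phi> X = \<Phi> X"
    using linear_superop_carrier[OF \<Phi> XC] unfolding ampliation_def
    by (intro eq_matI) simp_all
  moreover have "psd (1 * D) (ampliation 1 D \<Phi> X)"
    using cp X unfolding completely_positive_def by (metis mult_1)
  ultimately show ?thesis by simp
qed

section \<open>Pure states and fidelity\<close>

lemma ket_bra_carrier: "v \<in> carrier_vec D \<Longrightarrow> ket_bra v \<in> carrier_mat D D"
  unfolding ket_bra_def by simp

lemma ket_bra_mult_vec:
  assumes "\<psi> \<in> carrier_vec D" "v \<in> carrier_vec D"
  shows "ket_bra \<psi> *\<^sub>v v = (v \<bullet>c \<psi>) \<cdot>\<^sub>v \<psi>"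
  by (rule eq_vecI)
    (use assms in \<open>simp_all add: ket_bra_def scalar_prod_def sum_distrib_left mult_ac\<close>)

lemma quad_form_ket_bra:
  assumes "\<psi> \<in> carrier_vec D" "v \<in> carrier_vec D"
  shows "quad_form D (ket_bra \<psi>) v = (v \<bullet>c \<psi>) * cnj (v \<bullet>c \<psi>)"
proof -
  have "\<psi> \<bullet>c v = cnj (v \<bullet>c \<psi>)"
    using assms by (simp add: scalar_prod_def mult.commute)
  then show ?thesis
    using assms cscalar_prod_mult_mat_vec[OF ket_bra_carrier[OF assms(1)] assms(2)]
    by (simp add: ket_bra_mult_vec)
qed

lemma psd_ket_bra: "\<psi> \<in> carrier_vec D \<Longrightarrow> psd D (ket_bra \<psi>)"
  unfolding psd_iff_quad_form
  by (auto simp: quad_form_ket_bra ket_bra_carrier complex_mult_cnj less_eq_complex_def)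

text \<open>Links the trace in the logical error to quadratic forms, on which positivity
  acts.\<close>

lemma trace_ket_bra_mult:
  assumes "\<psi> \<in> carrier_vec D" "Y \<in> carrier_mat D D"
  shows "mat_trace (ket_bra \<psi> * Y) = quad_form D Y \<psi>"
proof -
  have "mat_trace (ket_bra \<psi> * Y) = (\<Sum>i<D. \<Sum>j<D. \<psi> $ i * cnj (\<psi> $ j) * Y $$ (j, i))"
    using assms by (simp add: mat_trace_def ket_bra_def scalar_prod_def atLeast0LessThan)
  also have "\<dots> = (\<Sum>j<D. \<Sum>i<D. \<psi> $ i * cnj (\<psi> $ j) * Y $$ (j, i))" by (rule sum.swap)
  finally show ?thesis by (simp add: quad_form_def mult_ac)
qed

lemma linear_functional_quad_form:
  assumes "linear_superop D \<Phi>"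
  shows "linear_functional D (\<lambda>X. quad_form D (\<Phi> X) v)"
  unfolding linear_functional_def
  using linear_superop_carrier[OF assms]
  by (simp add: linear_superop_add[OF assms] linear_superop_smult[OF assms] quad_form_add quad_form_smult)

lemma density_operator_ket_bra:
  assumes "\<psi> \<in> carrier_vec D" "\<psi> \<bullet>c \<psi> = 1"
  shows "density_operator D (ket_bra \<psi>)"
proof -
  have "mat_trace (ket_bra \<psi>) = \<psi> \<bullet>c \<psi>"
    using assms by (simp add: mat_trace_def ket_bra_def scalar_prod_def atLeast0LessThan)
  then show ?thesis using assms psd_ket_bra by (simp add: density_operator_def)
qed

section \<open>Code states and the recovery map\<close>

lemma codespaceD:
  assumes "codespace n C"
  shows "C \<subseteq> carrier_vec (2 ^ n)" "v \<in> C \<Longrightarrow> a \<cdot>\<^sub>v v \<in> C"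
proof -
  interpret vs: vec_space "TYPE(complex)" "2 ^ n" .
  from assms have s: "VectorSpace.subspace class_ring C (module_vec TYPE(complex) (2 ^ n))"
    by (simp add: codespace_def)
  then have m: "LinearCombinations.submodule class_ring C (module_vec TYPE(complex) (2 ^ n))"
    by (simp add: VectorSpace.subspace_def)
  from m show "C \<subseteq> carrier_vec (2 ^ n)"
    unfolding submodule_def by (simp add: module_vec_simps)
  from m show "a \<cdot>\<^sub>v v \<in> C" if "v \<in> C"
    using that unfolding submodule_def by (simp add: module_vec_simps)
qed

lemma unit_vectors_carrier:
  assumes "codespace n C" "\<psi> \<in> unit_vectors C"
  shows "\<psi> \<in> carrier_vec (2 ^ n)"
  using assms codespaceD(1) unfolding unit_vectors_def by blast

text \<open>The projector onto a code state has its range in the span of that state, hence in the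
  codespace, so the recovery fixes it.\<close>

lemma recovery_map_ket_bra:
  assumes "codespace n C" "recovery_map n C R" "\<psi> \<in> unit_vectors C"
  shows "R (ket_bra \<psi>) = ket_bra \<psi>"
proof -
  have \<psi>: "\<psi> \<in> carrier_vec (2 ^ n)" by (rule unit_vectors_carrier[OF assms(1,3)])
  have "\<psi> \<in> C" "\<psi> \<bullet>c \<psi> = 1" using assms(3) unfolding unit_vectors_def by auto
  then have "density_operator (2 ^ n) (ket_bra \<psi>)" "supported_on (2 ^ n) (ket_bra \<psi>) C"
    using \<psi> codespaceD(2)[OF assms(1)]
    by (simp_all add: density_operator_ket_bra supported_on_def ket_bra_mult_vec)
  then show ?thesis using assms(2) unfolding recovery_map_def by blast
qed

text \<open>The recovery of a basis state has trace 1, so some diagonal entry is nonzero. The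
  corresponding column lies in the codespace and can be normalised. The infimum in the logical error
  is therefore over a nonempty set.\<close>

lemma unit_vectors_nonempty:
  assumes C: "codespace n C" and R: "recovery_map n C R"
  shows "unit_vectors C \<noteq> {}"
proof -
  let ?D = "2 ^ n :: nat"
  let ?\<rho> = "ket_bra (unit_vec ?D 0)"
  have u: "(unit_vec ?D 0 :: complex vec) \<in> carrier_vec ?D" by simp
  have "(unit_vec ?D 0 :: complex vec) \<bullet>c unit_vec ?D 0 = 1"
    by (simp add: scalar_prod_left_unit[OF carrier_vec_conjugate[OF unit_vec_carrier]])
  from density_operator_ket_bra[OF u this] have \<rho>: "density_operator ?D ?\<rho>" .
  have supp: "supported_on ?D (R ?\<rho>) C" using R \<rho> unfolding recovery_map_def by blast
  have lin: "linear_superop ?D R" and tr: "trace_preserving ?D R"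
    using R unfolding recovery_map_def cptp_def by auto
  note \<rho>C = ket_bra_carrier[OF u]
  have RC: "R ?\<rho> \<in> carrier_mat ?D ?D" by (rule linear_superop_carrier[OF lin \<rho>C])
  have "mat_trace (R ?\<rho>) = 1"
    using tr \<rho> \<rho>C unfolding trace_preserving_def density_operator_def by auto
  then have "\<exists>i<?D. R ?\<rho> $$ (i, i) \<noteq> 0"
    using RC unfolding mat_trace_def by (metis (no_types, lifting) carrier_matD(1) lessThan_iff sum.neutral zero_neq_one)
  then obtain i where i: "i < ?D" "R ?\<rho> $$ (i, i) \<noteq> 0" by blast
  define v where "v = R ?\<rho> *\<^sub>v unit_vec ?D i"
  have v: "v \<in> C" using supp unfolding supported_on_def v_def by simp
  then have vC: "v \<in> carrier_vec ?D" using codespaceD(1)[OF C] by blast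
  have "v $ i = R ?\<rho> $$ (i, i)" using RC i(1) unfolding v_def by simp
  then have "v \<noteq> 0\<^sub>v ?D" using i by auto
  then have pos: "0 < v \<bullet>c v" using vC by (simp add: conjugate_square_greater_0_vec)
  define r where "r = Re (v \<bullet>c v)"
  have r: "v \<bullet>c v = of_real r" "0 < r"
    using pos unfolding r_def by (auto simp: less_complex_def complex_eq_iff)
  have "(of_real (1 / sqrt r) \<cdot>\<^sub>v v) \<bullet>c (of_real (1 / sqrt r) \<cdot>\<^sub>v v) =
      of_real (1 / sqrt r) * (of_real (1 / sqrt r) * (v \<bullet>c v))"
    using vC by (simp add: conjugate_smult_vec)
  also have "\<dots> = of_real (1 / sqrt r * (1 / sqrt r * r))" unfolding r(1) by (simp only: of_real_mult)
  also have "1 / sqrt r * (1 / sqrt r * r) = 1" using r(2) by (simp add: field_simps)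
  finally have "of_real (1 / sqrt r) \<cdot>\<^sub>v v \<in> unit_vectors C"
    unfolding unit_vectors_def using codespaceD(2)[OF C v] by simp
  then show ?thesis by blast
qed

section \<open>The logical error\<close>

lemma linear_superop_mat_sum_fun:
  assumes "\<And>a. a \<in> A \<Longrightarrow> linear_superop D (\<Phi> a)"
  shows "linear_superop D (\<lambda>X. mat_sum D (\<lambda>a. \<Phi> a X) A)"
proof -
  have "\<Phi> a X \<in> carrier_mat D D" if "a \<in> A" "X \<in> carrier_mat D D" for a X
    using assms that linear_superop_carrier by blast
  note dims = carrier_matD[OF this]
  show ?thesis
    unfolding linear_superop_def
  proof (intro conjI ballI allI eq_matI)
    fix X Y :: "complex mat" and i j
    assume XY: "X \<in> carrier_mat D D" "Y \<in> carrier_mat D D"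
      and "i < dim_row (mat_sum D (\<lambda>a. \<Phi> a X) A + mat_sum D (\<lambda>a. \<Phi> a Y) A)"
        "j < dim_col (mat_sum D (\<lambda>a. \<Phi> a X) A + mat_sum D (\<lambda>a. \<Phi> a Y) A)"
    then have ij: "i < D" "j < D" by simp_all
    have "\<Phi> a (X + Y) $$ (i, j) = \<Phi> a X $$ (i, j) + \<Phi> a Y $$ (i, j)" if "a \<in> A" for a
      using linear_superop_add[OF assms[OF that] XY] dims[OF that] XY ij by simp
    then show "mat_sum D (\<lambda>a. \<Phi> a (X + Y)) A $$ (i, j) =
        (mat_sum D (\<lambda>a. \<Phi> a X) A + mat_sum D (\<lambda>a. \<Phi> a Y) A) $$ (i, j)"
      using ij by (simp add: sum.distrib)
  next
    fix X :: "complex mat" and c i j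
    assume X: "X \<in> carrier_mat D D"
      and "i < dim_row (c \<cdot>\<^sub>m mat_sum D (\<lambda>a. \<Phi> a X) A)" "j < dim_col (c \<cdot>\<^sub>m mat_sum D (\<lambda>a. \<Phi> a X) A)"
    then have ij: "i < D" "j < D" by simp_all
    have "\<Phi> a (c \<cdot>\<^sub>m X) $$ (i, j) = c * \<Phi> a X $$ (i, j)" if "a \<in> A" for a
      using linear_superop_smult[OF assms[OF that] X] dims[OF that X] ij by simp
    then show "mat_sum D (\<lambda>a. \<Phi> a (c \<cdot>\<^sub>m X)) A $$ (i, j) = (c \<cdot>\<^sub>m mat_sum D (\<lambda>a. \<Phi> a X) A) $$ (i, j)"
      using ij by (simp add: sum_distrib_left)
  qed simp_all
qed

lemma linear_superop_combine:
  assumes \<Phi>: "linear_superop D \<Phi>" and \<Psi>: "linear_superop D \<Psi>"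
  shows "linear_superop D (\<lambda>X. a \<cdot>\<^sub>m \<Phi> X + b \<cdot>\<^sub>m \<Psi> X)"
  unfolding linear_superop_def
proof (intro conjI ballI allI)
  note cs = linear_superop_carrier[OF \<Phi>] linear_superop_carrier[OF \<Psi>]
  note dims = carrier_matD[OF cs(1)] carrier_matD[OF cs(2)]
  fix X :: "complex mat" assume X: "X \<in> carrier_mat D D"
  show "a \<cdot>\<^sub>m \<Phi> X + b \<cdot>\<^sub>m \<Psi> X \<in> carrier_mat D D" using cs X by simp
  show "a \<cdot>\<^sub>m \<Phi> (c \<cdot>\<^sub>m X) + b \<cdot>\<^sub>m \<Psi> (c \<cdot>\<^sub>m X) = c \<cdot>\<^sub>m (a \<cdot>\<^sub>m \<Phi> X + b \<cdot>\<^sub>m \<Psi> X)" for c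
    unfolding linear_superop_smult[OF \<Phi> X] linear_superop_smult[OF \<Psi> X]
    using dims[OF X] by (intro eq_matI) (simp_all add: algebra_simps)
  fix Y :: "complex mat" assume Y: "Y \<in> carrier_mat D D"
  show "a \<cdot>\<^sub>m \<Phi> (X + Y) + b \<cdot>\<^sub>m \<Psi> (X + Y) = a \<cdot>\<^sub>m \<Phi> X + b \<cdot>\<^sub>m \<Psi> X + (a \<cdot>\<^sub>m \<Phi> Y + b \<cdot>\<^sub>m \<Psi> Y)"
    unfolding linear_superop_add[OF \<Phi> X Y] linear_superop_add[OF \<Psi> X Y]
    using dims[OF X] dims[OF Y] by (intro eq_matI) (simp_all add: algebra_simps)
qed

text \<open>The Lindbladian without its decay term \<open>- (\<kappa> + N \<Delta>) X\<close>; it preserves positivity.\<close>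

definition jump_map ::
    "nat \<Rightarrow> nat \<Rightarrow> (nat \<Rightarrow> complex mat) \<Rightarrow> (complex mat \<Rightarrow> complex mat) \<Rightarrow> real \<Rightarrow> real \<Rightarrow>
      complex mat \<Rightarrow> complex mat" where
  "jump_map n N E R \<kappa> \<Delta> X = of_real \<kappa> \<cdot>\<^sub>m R X +
     of_real \<Delta> \<cdot>\<^sub>m mat_sum (2 ^ n) (\<lambda>\<mu>. conj_map (E \<mu>) X) {1..N}"

lemma linear_superop_jump_map:
  assumes "pauli_noise n N E" "linear_superop (2 ^ n) R"
  shows "linear_superop (2 ^ n) (jump_map n N E R \<kappa> \<Delta>)"
proof -
  have "linear_superop (2 ^ n) (\<lambda>X. mat_sum (2 ^ n) (\<lambda>\<mu>. conj_map (E \<mu>) X) {1..N})"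
    by (intro linear_superop_mat_sum_fun linear_superop_conj_map pauli_noiseD(1)[OF assms(1)])
  from linear_superop_combine[OF assms(2) this] show ?thesis
    unfolding jump_map_def[abs_def] .
qed

lemma psd_jump_map:
  assumes "pauli_noise n N E" "\<And>X. psd (2 ^ n) X \<Longrightarrow> psd (2 ^ n) (R X)"
    and "0 \<le> \<kappa>" "0 \<le> \<Delta>" and X: "psd (2 ^ n) X"
  shows "psd (2 ^ n) (jump_map n N E R \<kappa> \<Delta> X)"
  unfolding jump_map_def using assms(3,4)
  by (intro psd_add psd_smult psd_mat_sum assms(2) X psd_conj_map[OF pauli_noiseD(1)[OF assms(1)]])
    (simp_all add: less_eq_complex_def)

text \<open>This includes weights above \<open>N\<close>: there the sum is empty and
  \<open>1 / 0 = 0\<close>, which gives the zero matrix. Weight \<open>h + 1\<close> with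
  \<open>h = N\<close> is such a case.\<close>

lemma psd_weight_channel:
  assumes E: "pauli_noise n N E" and X: "psd (2 ^ n) X"
  shows "psd (2 ^ n) (weight_channel n N E k X)"
  unfolding weight_channel_def conj_map_def[symmetric]
proof (intro psd_smult psd_mat_sum psd_conj_map X error_product_carrier[OF E])
  show "S \<subseteq> {1..N}" if "S \<in> error_subsets N k" for S
    using that by (simp add: error_subsets_def)
  have "(0 :: complex) \<le> of_real (1 / real (card (error_subsets N k)))"
    by (simp add: less_eq_complex_def)
  then show "(0 :: complex) \<le> 1 / of_nat (card (error_subsets N k))" by simp
qed

lemma uniform_noise_rates:
  assumes "noise_rates N rate" "uniform_rates N rate" "\<mu> \<in> {1..N}"
  shows "rate \<mu> = 1"
proof -
  have "real N = (\<Sum>\<nu>\<in>{1..N}. rate \<nu>)" using assms(1) by (simp add: noise_rates_def)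
  also have "\<dots> = (\<Sum>\<nu>\<in>{1..N}. rate \<mu>)"
    using assms(2,3) unfolding uniform_rates_def by (intro sum.cong) blast+
  also have "\<dots> = real N * rate \<mu>" by simp
  finally have "real N * (rate \<mu> - 1) = 0" by (simp add: algebra_simps)
  then show ?thesis using assms(3) by auto
qed

text \<open>Pauli operators are unitary, so each anticommutator term reduces to \<open>X\<close>.
  The \<open>N\<close> of them and the loss term of the recovery add up to the decay rate
  \<open>\<kappa> + N * \<Delta>\<close>.\<close>

lemma full_lindbladian_eq_jump_map:
  assumes E: "pauli_noise n N E" and R: "linear_superop (2 ^ n) R"
    and rate: "\<And>\<mu>. \<mu> \<in> {1..N} \<Longrightarrow> rate \<mu> = 1" and X: "X \<in> carrier_mat (2 ^ n) (2 ^ n)"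
  shows "full_lindbladian n N rate E R \<kappa> \<Delta> X =
    jump_map n N E R \<kappa> \<Delta> X + of_real (- (\<kappa> + real N * \<Delta>)) \<cdot>\<^sub>m X" (is "?L = ?J")
proof (rule eq_matI)
  let ?D = "2 ^ n :: nat"
  note RX = linear_superop_carrier[OF R X]
  fix i j assume "i < dim_row ?J" "j < dim_col ?J"
  then have ij: "i < ?D" "j < ?D" using X by simp_all
  have noise: "(of_real (rate \<mu>) \<cdot>\<^sub>m (E \<mu> * X * mat_adjoint (E \<mu>) -
      (1 / 2) \<cdot>\<^sub>m (mat_adjoint (E \<mu>) * E \<mu> * X + X * (mat_adjoint (E \<mu>) * E \<mu>)))) $$ (i, j) =
      conj_map (E \<mu>) X $$ (i, j) - X $$ (i, j)" if \<mu>: "\<mu> \<in> {1..N}" for \<mu>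
  proof -
    have "mat_adjoint (E \<mu>) * E \<mu> = 1\<^sub>m ?D"
      using pauli_noiseD[OF E \<mu>] by simp
    moreover have "conj_map (E \<mu>) X \<in> carrier_mat ?D ?D"
      by (rule conj_map_carrier[OF pauli_noiseD(1)[OF E \<mu>] X])
    ultimately show ?thesis
      using X ij by (simp add: rate[OF \<mu>] conj_map_def[symmetric])
  qed
  have "noise_lindbladian n N rate E X $$ (i, j) =
      (\<Sum>\<mu>\<in>{1..N}. conj_map (E \<mu>) X $$ (i, j) - X $$ (i, j))"
    unfolding noise_lindbladian_def mat_sum_index[OF ij] by (rule sum.cong[OF refl noise])
  then have noise_sum: "noise_lindbladian n N rate E X $$ (i, j) =
      (\<Sum>\<mu>\<in>{1..N}. conj_map (E \<mu>) X $$ (i, j)) - of_nat N * X $$ (i, j)"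
    by (simp add: sum_subtractf)
  have "noise_lindbladian n N rate E X \<in> carrier_mat ?D ?D"
    by (simp add: noise_lindbladian_def)
  then have "?L $$ (i, j) = of_real \<kappa> * (R X $$ (i, j) - X $$ (i, j)) +
      of_real \<Delta> * noise_lindbladian n N rate E X $$ (i, j)"
    using X RX ij by (simp add: full_lindbladian_def recovery_lindbladian_def)
  also have "\<dots> = ?J $$ (i, j)"
    unfolding noise_sum using X RX ij by (simp add: jump_map_def algebra_simps)
  finally show "?L $$ (i, j) = ?J $$ (i, j)" .
qed (use X in \<open>simp_all add: full_lindbladian_def noise_lindbladian_def\<close>)

text \<open>A discrete maximum principle: in the recurrence the two coefficients are nonnegative and
  sum to \<open>p < 1\<close>.\<close>

lemma recurrence_bounds:
  fixes s :: "nat \<Rightarrow> real"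
  assumes p: "0 \<le> p" "p < 1" and "h \<le> N" and "s 0 = 0" "s (h + 1) = 1"
    and rec: "\<And>v. 1 \<le> v \<Longrightarrow> v \<le> h \<Longrightarrow>
      s v = real v / real N * p * s (v - 1) + (1 - real v / real N) * p * s (v + 1)"
    and "v \<le> h + 1"
  shows "0 \<le> s v" "s v \<le> 1"
proof -
  \<comment> \<open>Stated for an arbitrary solution \<open>u\<close>, so that it can be used for
    \<open>s\<close> and for \<open>- s\<close>. The maximum with 0 covers an interior maximum,
    which cannot be positive.\<close>
  have max_principle: "\<exists>v\<in>{0, h + 1}. \<forall>w\<le>h + 1. u w \<le> max 0 (u v)"
    if urec: "\<And>v. 1 \<le> v \<Longrightarrow> v \<le> h \<Longrightarrow>
      u v = real v / real N * p * u (v - 1) + (1 - real v / real N) * p * u (v + 1)" for u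
  proof -
    define M where "M = Max (u ` {..h + 1})"
    have le: "u w \<le> M" if "w \<le> h + 1" for w
      unfolding M_def using that by (intro Max_ge) auto
    have "M \<in> u ` {..h + 1}" unfolding M_def by (rule Max_in) auto
    then obtain v where v: "v \<le> h + 1" "u v = M" by auto
    show ?thesis
    proof (cases "v \<in> {0, h + 1}")
      case True
      with le v show ?thesis by (auto intro!: bexI[of _ v] simp: max.coboundedI2)
    next
      case False
      then have v': "1 \<le> v" "v \<le> h" using v(1) by auto
      let ?a = "real v / real N"
      have a: "0 \<le> ?a" "?a \<le> 1" using v' \<open>h \<le> N\<close> by auto
      \<comment> \<open>At an interior maximum the recurrence gives \<open>M \<le> p * M\<close>,
        hence \<open>M \<le> 0\<close>.\<close>
      have "M = ?a * p * u (v - 1) + (1 - ?a) * p * u (v + 1)" using urec[OF v'] v(2) by simp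
      also have "\<dots> \<le> ?a * p * M + (1 - ?a) * p * M"
        using a p v' by (intro add_mono mult_left_mono le) auto
      also have "\<dots> = p * M" by (simp add: algebra_simps)
      finally have "(1 - p) * M \<le> 0" by (simp add: algebra_simps)
      then have "M \<le> 0" using p by (simp add: mult_le_0_iff)
      with le show ?thesis by (intro bexI[of _ 0]) (force intro: max.coboundedI1)+
    qed
  qed
  from max_principle[of s, OF rec] \<open>v \<le> h + 1\<close> assms(4,5) show "s v \<le> 1" by force
  \<comment> \<open>The recurrence is homogeneous, and \<open>- s\<close> has boundary values 0 and
    -1, so it never exceeds 0.\<close>
  have "- s v = real v / real N * p * - s (v - 1) + (1 - real v / real N) * p * - s (v + 1)"
    if "1 \<le> v" "v \<le> h" for v
    using rec[OF that] by simp
  from max_principle[of "\<lambda>v. - s v", OF this] \<open>v \<le> h + 1\<close> assms(4,5) show "0 \<le> s v" by force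
qed

text \<open>A supersolution for the walk of the error weight: \<open>s v\<close> is the probability that the weight,
  started at \<open>v\<close>, exceeds \<open>h\<close> before the first recovery. At weight \<open>0\<close> the recovery succeeds
  exactly, so the factor \<open>1 - \<xi>\<close> is dropped there.\<close>

lemma jump_map_fidelity:
  fixes s :: "nat \<Rightarrow> real"
  assumes E: "pauli_noise n N E" and lin: "linear_superop (2 ^ n) R"
    and pos: "\<And>X. psd (2 ^ n) X \<Longrightarrow> psd (2 ^ n) (R X)"
    and \<psi>: "\<psi> \<in> carrier_vec (2 ^ n)" "\<psi> \<bullet>c \<psi> = 1" and fixP: "R (ket_bra \<psi>) = ket_bra \<psi>"
    and "0 < \<kappa>" "0 < \<Delta>" and \<xi>: "0 \<le> \<xi>" "\<xi> \<le> 1" and "h \<le> N" "1 \<le> N"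
    and tol: "\<And>k. k \<le> h \<Longrightarrow> psd (2 ^ n) (R (weight_channel n N E k (ket_bra \<psi>))
      - of_real (1 - \<xi>) \<cdot>\<^sub>m ket_bra \<psi>)"
    and s: "s 0 = 0" "s (h + 1) = 1" "\<And>v. v \<le> h + 1 \<Longrightarrow> s v \<le> 1" "\<And>v. v \<le> h + 1 \<Longrightarrow> 0 \<le> s v"
    and rec: "\<And>v. 1 \<le> v \<Longrightarrow> v \<le> h \<Longrightarrow>
      (\<kappa> + real N * \<Delta>) * s v = \<Delta> * real v * s (v - 1) + \<Delta> * real (N - v) * s (v + 1)"
    and "v \<le> h + 1"
  shows "(\<kappa> + real N * \<Delta> * (1 - \<xi>) * (1 - s 1)) ^ m * (if v = 0 then 1 else (1 - \<xi>) * (1 - s v)) \<le>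
    Re (quad_form (2 ^ n) (R ((jump_map n N E R \<kappa> \<Delta> ^^ m) (weight_channel n N E v (ket_bra \<psi>)))) \<psi>)"
  using \<open>v \<le> h + 1\<close>
proof (induction m arbitrary: v)
  case 0
  let ?D = "2 ^ n :: nat" and ?P = "ket_bra \<psi>"
  let ?W = "\<lambda>v. weight_channel n N E v (ket_bra \<psi>)"
  have P: "?P \<in> carrier_mat ?D ?D" "psd ?D ?P" using \<psi>(1) ket_bra_carrier psd_ket_bra by blast+
  have qP: "quad_form ?D ?P \<psi> = 1" using \<psi> by (simp add: quad_form_ket_bra)
  have qpos: "0 \<le> Re (quad_form ?D X \<psi>)" if "psd ?D X" for X
    using that \<psi>(1) unfolding psd_iff_quad_form by (auto simp: less_eq_complex_def)
  consider "v = 0" | "v = h + 1" | "1 \<le> v" "v \<le> h" using 0 by linarith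
  then show ?case
  proof cases
    case 1
    then show ?thesis using fixP qP by (simp add: weight_channel_zero[OF P(1)])
  next
    \<comment> \<open>At weight \<open>h + 1\<close> the tolerance says nothing, but
      \<open>s (h + 1) = 1\<close> makes the claimed bound zero and positivity suffices.\<close>
    case 2
    then show ?thesis using s(2) qpos[OF pos[OF psd_weight_channel[OF E P(2)]]] by simp
  next
    case 3
    let ?Z = "R (?W v) - of_real (1 - \<xi>) \<cdot>\<^sub>m ?P"
    have RW: "R (?W v) \<in> carrier_mat ?D ?D" by (rule linear_superop_carrier[OF lin weight_channel_carrier])
    have "R (?W v) = ?Z + of_real (1 - \<xi>) \<cdot>\<^sub>m ?P" using RW P(1) by (intro eq_matI) simp_all
    then have "quad_form ?D (R (?W v)) \<psi> = quad_form ?D ?Z \<psi> + of_real (1 - \<xi>)"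
      using quad_form_add[OF psd_carrier[OF tol[OF 3(2)]] smult_carrier_mat[OF P(1)], of "of_real (1 - \<xi>)" \<psi>]
        quad_form_smult[OF P(1), of "of_real (1 - \<xi>)" \<psi>] qP by simp
    then have "1 - \<xi> \<le> Re (quad_form ?D (R (?W v)) \<psi>)"
      using qpos[OF tol[OF 3(2)]] by simp
    moreover have "(1 - \<xi>) * (1 - s v) \<le> (1 - \<xi>) * 1"
      using \<xi> s(4)[of v] 3 by (intro mult_left_mono) auto
    ultimately show ?thesis using 3 by simp
  qed
next
  case (Suc m)
  let ?D = "2 ^ n :: nat" and ?P = "ket_bra \<psi>"
  let ?W = "\<lambda>v. weight_channel n N E v (ket_bra \<psi>)"
  let ?K = "jump_map n N E R \<kappa> \<Delta>"
  let ?r = "\<kappa> + real N * \<Delta> * (1 - \<xi>) * (1 - s 1)"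
  let ?f = "\<lambda>v. if v = 0 then 1 else (1 - \<xi>) * (1 - s v)"
  \<comment> \<open>\<open>G\<close> is the fidelity after the remaining \<open>m\<close> jumps. The
    first of the \<open>m + 1\<close> jumps is expanded explicitly and the hypothesis bounds
    \<open>G\<close> on the outcome.\<close>
  define G where "G X = Re (quad_form ?D (R ((?K ^^ m) X)) \<psi>)" for X
  have P: "?P \<in> carrier_mat ?D ?D" "psd ?D ?P" using \<psi>(1) ket_bra_carrier psd_ket_bra by blast+
  have psdK: "psd ?D ((?K ^^ k) X)" if "psd ?D X" for X k
    using that by (induction k) (auto intro: psd_jump_map[OF E pos] simp: less_imp_le[OF \<open>0 < \<kappa>\<close>] less_imp_le[OF \<open>0 < \<Delta>\<close>])
  have Gpos: "0 \<le> G X" if "psd ?D X" for X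
    using pos[OF psdK[OF that]] \<psi>(1) unfolding G_def psd_iff_quad_form by (auto simp: less_eq_complex_def)
  have linK: "linear_superop ?D ?K" by (rule linear_superop_jump_map[OF E lin])
  have "linear_superop ?D (\<lambda>X. R ((?K ^^ m) X))"
    using linear_superop_funpow[OF linK, of m] lin unfolding linear_superop_def by simp
  note lf = linear_functional_quad_form[OF this, of \<psi>]
  have Gadd: "G (X + Y) = G X + G Y" if "X \<in> carrier_mat ?D ?D" "Y \<in> carrier_mat ?D ?D" for X Y
    unfolding G_def linear_functional_add[OF lf that] by simp
  have Gsmult: "G (of_real a \<cdot>\<^sub>m X) = a * G X" if "X \<in> carrier_mat ?D ?D" for X a
    unfolding G_def linear_functional_smult[OF lf that] by simp
  have IH: "?r ^ m * ?f v \<le> G (?W v)" if "v \<le> h + 1" for v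
    unfolding G_def by (rule Suc.IH[OF that])
  have IHP: "?r ^ m \<le> G ?P" using IH[of 0] by (simp add: weight_channel_zero[OF P(1)])
  \<comment> \<open>One jump is a recovery or an error that lowers or raises the weight. At
    \<open>v = 0\<close> the lowering term has coefficient 0.\<close>
  have Gstep: "Re (quad_form ?D (R ((?K ^^ Suc m) (?W v))) \<psi>) =
      \<kappa> * G (R (?W v)) + \<Delta> * real v * G (?W (v - 1)) + \<Delta> * real (N - v) * G (?W (v + 1))"
    if "v \<le> N" for v
  proof -
    note c = weight_channel_carrier[of n N E _ ?P]
    note Rc = linear_superop_carrier[OF lin c]
    have "?K (?W v) = of_real \<kappa> \<cdot>\<^sub>m R (?W v) +
        of_real \<Delta> \<cdot>\<^sub>m (of_real (real v) \<cdot>\<^sub>m ?W (v - 1) + of_real (real (N - v)) \<cdot>\<^sub>m ?W (v + 1))"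
      unfolding jump_map_def sum_conj_map_weight_channel[OF E that P(1)] by (simp add: Suc_eq_plus1)
    then have "G (?K (?W v)) = \<kappa> * G (R (?W v)) +
        \<Delta> * (real v * G (?W (v - 1)) + real (N - v) * G (?W (v + 1)))"
      using c Rc by (simp only: Gadd Gsmult add_carrier_mat smult_carrier_mat)
    moreover have "Re (quad_form ?D (R ((?K ^^ Suc m) (?W v))) \<psi>) = G (?K (?W v))"
      unfolding G_def by (simp only: funpow_Suc_right comp_apply)
    ultimately show ?thesis by (simp add: algebra_simps)
  qed
  have fnn: "0 \<le> ?f v" if "v \<le> h + 1" for v
    using \<xi> s(3)[OF that] by simp
  \<comment> \<open>The lower bound makes the powers of \<open>r\<close> nonnegative; the upper one
    allows \<open>r\<close> to be replaced by the total rate at the weights from 1 to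
    \<open>h\<close>.\<close>
  have rle: "0 \<le> ?r" "?r \<le> \<kappa> + real N * \<Delta>"
  proof -
    have "0 \<le> (1 - \<xi>) * (1 - s 1)" using \<xi> s(3)[of 1] by simp
    moreover have "(1 - \<xi>) * (1 - s 1) \<le> 1 * 1" using \<xi> s(3)[of 1] s(4)[of 1] by (intro mult_mono) auto
    moreover have "0 \<le> real N * \<Delta>" using \<open>0 < \<Delta>\<close> by simp
    ultimately have "0 \<le> real N * \<Delta> * ((1 - \<xi>) * (1 - s 1))"
      "real N * \<Delta> * ((1 - \<xi>) * (1 - s 1)) \<le> real N * \<Delta> * (1 * 1)"
      by (blast intro: mult_nonneg_nonneg mult_left_mono)+
    then show "0 \<le> ?r" "?r \<le> \<kappa> + real N * \<Delta>" using \<open>0 < \<kappa>\<close> by (simp_all add: mult.assoc)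
  qed
  have rm: "0 \<le> ?r ^ m" using rle(1) by (rule zero_le_power)
  consider "v = 0" | "v = h + 1" | "1 \<le> v" "v \<le> h" using Suc.prems by linarith
  then show ?case
  proof cases
    case 1
    \<comment> \<open>The value of \<open>r\<close> is determined here: at weight 0 it is exactly
      \<open>\<kappa> * f 0 + N * \<Delta> * f 1\<close>.\<close>
    have "?r ^ Suc m * ?f v = \<kappa> * ?r ^ m + \<Delta> * real N * (?r ^ m * ?f 1)"
      using 1 by (simp add: algebra_simps)
    also have "\<dots> \<le> \<kappa> * G ?P + \<Delta> * real N * G (?W 1)"
      using IHP IH[of 1] \<open>0 < \<kappa>\<close> \<open>0 < \<Delta>\<close> by (intro add_mono mult_left_mono) auto
    also have "\<dots> = Re (quad_form ?D (R ((?K ^^ Suc m) (?W v))) \<psi>)"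
      using 1 Gstep[of 0] fixP by (simp add: weight_channel_zero[OF P(1)])
    finally show ?thesis .
  next
    case 2
    have "?r ^ Suc m * ?f v = 0" using 2 s(2) by simp
    also have "0 \<le> Re (quad_form ?D (R ((?K ^^ Suc m) (?W v))) \<psi>)"
      using pos[OF psdK[OF psd_weight_channel[OF E P(2)], of "Suc m"]] \<psi>(1)
      unfolding psd_iff_quad_form by (auto simp: less_eq_complex_def)
    finally show ?thesis .
  next
    case 3
    let ?Z = "R (?W v) - of_real (1 - \<xi>) \<cdot>\<^sub>m ?P"
    have vN: "v \<le> N" using 3 \<open>h \<le> N\<close> by simp
    have RW: "R (?W v) \<in> carrier_mat ?D ?D" by (rule linear_superop_carrier[OF lin weight_channel_carrier])
    have "R (?W v) = ?Z + of_real (1 - \<xi>) \<cdot>\<^sub>m ?P" using RW P(1) by (intro eq_matI) simp_all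
    \<comment> \<open>\<open>Z\<close> is the positive remainder provided by the tolerance. Dropping
      it says that the recovery resets the weight to 0 with weight factor
      \<open>1 - \<xi>\<close>.\<close>
    then have "G (R (?W v)) = G ?Z + (1 - \<xi>) * G ?P"
      using Gadd[OF psd_carrier[OF tol[OF 3(2)]] smult_carrier_mat[OF P(1)]] Gsmult[OF P(1)] by metis
    then have GR: "(1 - \<xi>) * ?r ^ m \<le> G (R (?W v))"
      using Gpos[OF tol[OF 3(2)]] mult_left_mono[OF IHP, of "1 - \<xi>"] \<xi> by simp
    \<comment> \<open>Since \<open>f 0 = 1\<close> is at least \<open>1 - \<xi>\<close>, one formula
      serves as a lower bound at all neighbouring weights, including 0.\<close>
    have fge: "(1 - \<xi>) * (1 - s w) \<le> ?f w" for w
      using \<xi> s(1) by simp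
    have Gw: "?r ^ m * ((1 - \<xi>) * (1 - s w)) \<le> G (?W w)" if "w \<le> h + 1" for w
      using mult_left_mono[OF fge rm] IH[OF that] by (rule order_trans)
    have "?r ^ Suc m * ?f v = ?r ^ m * (?r * ?f v)" by (simp only: power_Suc mult_ac)
    also have "\<dots> \<le> ?r ^ m * ((\<kappa> + real N * \<Delta>) * ?f v)"
      by (rule mult_left_mono[OF mult_right_mono[OF rle(2) fnn[OF Suc.prems]] rm])
    also have "(\<kappa> + real N * \<Delta>) * ?f v = (1 - \<xi>) * (\<kappa> + real N * \<Delta> - (\<kappa> + real N * \<Delta>) * s v)"
      using 3 by (simp add: algebra_simps)
    \<comment> \<open>The rates \<open>\<kappa>\<close>, \<open>\<Delta> * v\<close> and
      \<open>\<Delta> * (N - v)\<close> add up to the total rate, so the recurrence for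
      \<open>s\<close> becomes one for \<open>1 - s\<close> with source
      \<open>\<kappa>\<close>.\<close>
    also have "\<kappa> + real N * \<Delta> - (\<kappa> + real N * \<Delta>) * s v =
        \<kappa> + \<Delta> * real v * (1 - s (v - 1)) + \<Delta> * real (N - v) * (1 - s (v + 1))"
      unfolding rec[OF 3] using vN by (simp add: of_nat_diff algebra_simps)
    also have "?r ^ m * ((1 - \<xi>) * (\<kappa> + \<Delta> * real v * (1 - s (v - 1)) + \<Delta> * real (N - v) * (1 - s (v + 1)))) =
        \<kappa> * ((1 - \<xi>) * ?r ^ m) + \<Delta> * real v * (?r ^ m * ((1 - \<xi>) * (1 - s (v - 1)))) +
        \<Delta> * real (N - v) * (?r ^ m * ((1 - \<xi>) * (1 - s (v + 1))))"
      by (simp only: distrib_left distrib_right mult_ac)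
    also have "\<dots> \<le> \<kappa> * G (R (?W v)) + \<Delta> * real v * G (?W (v - 1)) + \<Delta> * real (N - v) * G (?W (v + 1))"
      using 3 \<open>0 < \<kappa>\<close> \<open>0 < \<Delta>\<close> by (intro add_mono mult_left_mono GR Gw) auto
    also have "\<dots> = Re (quad_form ?D (R ((?K ^^ Suc m) (?W v))) \<psi>)"
      by (rule Gstep[OF vN, symmetric])
    finally show ?thesis .
  qed
qed

text \<open>The bound for a single code. The fidelity is \<open>exp (- \<Gamma> * t)\<close> times a
  series whose terms are at least those of \<open>exp (r * t)\<close>, so it is at least
  \<open>exp ((r - \<Gamma>) * t)\<close>.\<close>

lemma logical_error_bound:
  fixes s :: "nat \<Rightarrow> real"
  assumes C: "codespace n C" and R: "recovery_map n C R" and N: "1 \<le> N"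
    and E: "pauli_noise n N E" and rate: "noise_rates N rate" "uniform_rates N rate"
    and \<kappa>: "0 < \<kappa>" and \<Delta>: "0 < \<Delta>" and \<xi>: "0 \<le> \<xi>" "\<xi> \<le> 1" and h: "h \<le> N"
    and tol: "\<And>\<psi> k. \<psi> \<in> unit_vectors C \<Longrightarrow> k \<le> h \<Longrightarrow>
      psd (2 ^ n) (R (weight_channel n N E k (ket_bra \<psi>)) - of_real (1 - \<xi>) \<cdot>\<^sub>m ket_bra \<psi>)"
    and s: "s 0 = 0" "s (h + 1) = 1"
    and rec: "\<And>v. 1 \<le> v \<Longrightarrow> v \<le> h \<Longrightarrow>
      s v = real v / real N * (real N * \<Delta> / (\<kappa> + real N * \<Delta>)) * s (v - 1) +
        (1 - real v / real N) * (real N * \<Delta> / (\<kappa> + real N * \<Delta>)) * s (v + 1)"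
    and t: "0 \<le> t"
  shows "logical_error n C R (full_lindbladian n N rate E R \<kappa> \<Delta>) t
    \<le> 1 - exp (- (1 - \<xi>) * real N * \<Delta> * s 1 * t - \<xi> * (\<kappa> + real N * \<Delta>) * t)"
proof -
  let ?D = "2 ^ n :: nat"
  let ?L = "full_lindbladian n N rate E R \<kappa> \<Delta>" and ?K = "jump_map n N E R \<kappa> \<Delta>"
  define \<Gamma> where "\<Gamma> = \<kappa> + real N * \<Delta>"
  define r where "r = \<kappa> + real N * \<Delta> * (1 - \<xi>) * (1 - s 1)"
  have N\<Delta>: "0 < real N * \<Delta>" using N \<Delta> by simp
  have \<Gamma>: "0 < \<Gamma>" using \<kappa> N\<Delta> by (simp add: \<Gamma>_def)
  have p: "0 \<le> real N * \<Delta> / (\<kappa> + real N * \<Delta>)" "real N * \<Delta> / (\<kappa> + real N * \<Delta>) < 1"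
    using \<kappa> N\<Delta> by simp_all
  note sb = recurrence_bounds[OF p h s rec]
  \<comment> \<open>The recurrence with the denominators \<open>N\<close> and
    \<open>\<Gamma>\<close> cleared, now an equation between jump rates.\<close>
  have rec': "(\<kappa> + real N * \<Delta>) * s v = \<Delta> * real v * s (v - 1) + \<Delta> * real (N - v) * s (v + 1)"
    if "1 \<le> v" "v \<le> h" for v
  proof -
    have "real v / real N * (real N * \<Delta> / \<Gamma>) = \<Delta> * real v / \<Gamma>" using N by simp
    moreover have "1 - real v / real N = real (N - v) / real N"
      using N h that by (simp add: diff_divide_distrib)
    then have "(1 - real v / real N) * (real N * \<Delta> / \<Gamma>) = \<Delta> * real (N - v) / \<Gamma>"
      using N by simp
    ultimately have "s v = \<Delta> * real v / \<Gamma> * s (v - 1) + \<Delta> * real (N - v) / \<Gamma> * s (v + 1)"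
      using rec[OF that] unfolding \<Gamma>_def[symmetric] by (simp only:)
    then have "s v = (\<Delta> * real v * s (v - 1) + \<Delta> * real (N - v) * s (v + 1)) / \<Gamma>"
      by (simp add: add_divide_distrib)
    then show ?thesis using \<Gamma> unfolding \<Gamma>_def[symmetric] by simp
  qed
  have lin: "linear_superop ?D R" and cp: "completely_positive ?D R"
    using R unfolding recovery_map_def cptp_def by auto
  have "exp (- (1 - \<xi>) * real N * \<Delta> * s 1 * t - \<xi> * (\<kappa> + real N * \<Delta>) * t) \<le>
      Re (mat_trace (ket_bra \<psi> * R (superop_exp ?D ?L t (ket_bra \<psi>))))"
    if \<psi>U: "\<psi> \<in> unit_vectors C" for \<psi>
  proof -
    have \<psi>: "\<psi> \<in> carrier_vec ?D" "\<psi> \<bullet>c \<psi> = 1"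
      using unit_vectors_carrier[OF C \<psi>U] \<psi>U unfolding unit_vectors_def by auto
    note P = ket_bra_carrier[OF \<psi>(1)]
    let ?g = "\<lambda>X. quad_form ?D (R X) \<psi>"
    let ?T = "?g (superop_exp ?D ?L t (ket_bra \<psi>))"
    \<comment> \<open>The walk starts at weight 0, where the comparison function equals 1.\<close>
    have low: "r ^ m \<le> Re (?g ((?K ^^ m) (ket_bra \<psi>)))" for m
      using jump_map_fidelity[where \<xi> = \<xi> and s = s and h = h and v = 0 and m = m, OF E lin
          completely_positive_psd[OF cp lin] \<psi> recovery_map_ket_bra[OF C R \<psi>U] \<kappa> \<Delta> \<xi> h N tol[OF \<psi>U] s
          sb(2) sb(1) rec']
      by (simp add: weight_channel_zero[OF P] r_def)
    have exp_sums: "(\<lambda>m. of_real (t ^ m / fact m) * ?g ((?K ^^ m) (ket_bra \<psi>))) sums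
        (?T * of_real (exp (- (- \<Gamma> * t))))"
      unfolding \<Gamma>_def
      by (rule linear_functional_superop_exp[OF linear_superop_jump_map[OF E lin] _ P
          linear_functional_quad_form[OF lin]])
        (rule full_lindbladian_eq_jump_map[OF E lin uniform_noise_rates[OF rate]])
    have Re_of_real_mult: "Re (of_real a * z) = a * Re z"
      and Re_mult_of_real: "Re (z * of_real a) = Re z * a" for a z by simp_all
    from sums_Re[OF exp_sums]
    have fid_sums: "(\<lambda>m. t ^ m / fact m * Re (?g ((?K ^^ m) (ket_bra \<psi>)))) sums (Re ?T * exp (\<Gamma> * t))"
      by (simp only: Re_of_real_mult Re_mult_of_real mult_minus_left minus_minus)
    have pow_sums: "(\<lambda>m. t ^ m / fact m * r ^ m) sums exp (r * t)"
      using exp_converges[of "r * t"] by (simp add: power_mult_distrib field_simps)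
    have "t ^ m / fact m * r ^ m \<le> t ^ m / fact m * Re (?g ((?K ^^ m) (ket_bra \<psi>)))" for m
      by (rule mult_left_mono[OF low]) (use t in simp)
    from sums_le[OF this pow_sums fid_sums] have "exp (r * t) \<le> Re ?T * exp (\<Gamma> * t)" .
    then have "exp (r * t - \<Gamma> * t) \<le> Re ?T"
      by (simp add: exp_diff divide_le_eq)
    \<comment> \<open>The exponent obtained exceeds the claimed one by
      \<open>\<xi> * \<kappa> * t\<close>, since recovery at weight 0 loses nothing.\<close>
    moreover have "- (1 - \<xi>) * real N * \<Delta> * s 1 * t - \<xi> * (\<kappa> + real N * \<Delta>) * t \<le> r * t - \<Gamma> * t"
    proof -
      have "r * t - \<Gamma> * t - (- (1 - \<xi>) * real N * \<Delta> * s 1 * t - \<xi> * (\<kappa> + real N * \<Delta>) * t) = \<xi> * \<kappa> * t"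
        unfolding r_def \<Gamma>_def by (simp add: algebra_simps)
      moreover have "0 \<le> \<xi> * \<kappa> * t" using \<xi> \<kappa> t by simp
      ultimately show ?thesis by linarith
    qed
    ultimately have "exp (- (1 - \<xi>) * real N * \<Delta> * s 1 * t - \<xi> * (\<kappa> + real N * \<Delta>) * t) \<le> Re ?T"
      by (meson exp_le_cancel_iff order_trans)
    moreover have "superop_exp ?D ?L t (ket_bra \<psi>) \<in> carrier_mat ?D ?D" by (simp add: superop_exp_def)
    ultimately show ?thesis
      using trace_ket_bra_mult[OF \<psi>(1) linear_superop_carrier[OF lin]] by simp
  qed
  then show ?thesis
    unfolding logical_error_def
    by (simp only: diff_left_mono cINF_greatest[OF unit_vectors_nonempty[OF C R]])
qed

theorem theorem3:
  fixes I :: "nat set"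
    and C :: "nat \<Rightarrow> complex vec set"
    and d N h :: "nat \<Rightarrow> nat"
    and R :: "nat \<Rightarrow> complex mat \<Rightarrow> complex mat"
    and E :: "nat \<Rightarrow> nat \<Rightarrow> complex mat"
    and rate :: "nat \<Rightarrow> nat \<Rightarrow> real"
    and \<kappa> \<Delta> p\<^sub>1 :: "nat \<Rightarrow> real"
    and s :: "nat \<Rightarrow> nat \<Rightarrow> real"
  assumes "infinite I"
    and "\<And>n. n \<in> I \<Longrightarrow> codespace n (C n)"
    and "\<And>n. n \<in> I \<Longrightarrow> d n = code_distance n (C n)"
    and "\<And>n. n \<in> I \<Longrightarrow> recovery_map n (C n) (R n)"
    and "\<And>n. n \<in> I \<Longrightarrow> N n \<ge> 1"
    and "\<And>n. n \<in> I \<Longrightarrow> pauli_noise n (N n) (E n)"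
    and "\<And>n. n \<in> I \<Longrightarrow> noise_rates (N n) (rate n)"
    and "\<And>n. n \<in> I \<Longrightarrow> uniform_rates (N n) (rate n)"
    and "\<And>n. n \<in> I \<Longrightarrow> \<kappa> n > 0"
    and "\<And>n. n \<in> I \<Longrightarrow> \<Delta> n > 0"
    and "tolerable_error_weight I C d R N E h"
    and "\<And>n. n \<in> I \<Longrightarrow> p\<^sub>1 n = real (N n) * \<Delta> n / (\<kappa> n + real (N n) * \<Delta> n)"
    and "\<And>n. n \<in> I \<Longrightarrow> s n 0 = 0"
    and "\<And>n. n \<in> I \<Longrightarrow> s n (h n + 1) = 1"
    and "\<And>n v. n \<in> I \<Longrightarrow> 1 \<le> v \<Longrightarrow> v \<le> h n \<Longrightarrow>
           s n v = real v / real (N n) * p\<^sub>1 n * s n (v - 1)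
                   + (1 - real v / real (N n)) * p\<^sub>1 n * s n (v + 1)"
  shows "\<exists>\<xi>. (\<forall>n\<in>I. 0 \<le> \<xi> n \<and> \<xi> n \<le> 1) \<and> exp_small I d \<xi> \<and>
           (\<forall>n\<in>I. \<forall>t\<ge>0.
              logical_error n (C n) (R n)
                (full_lindbladian n (N n) (rate n) (E n) (R n) (\<kappa> n) (\<Delta> n)) t
              \<le> 1 - exp (- (1 - \<xi> n) * real (N n) * \<Delta> n * s n 1 * t
                          - \<xi> n * (\<kappa> n + real (N n) * \<Delta> n) * t))"
proof -
  \<comment> \<open>The \<open>\<xi>\<close> of the tolerance serves as the witness, so its decay in
    \<open>d\<close> is inherited and the bound can be proved separately for each
    \<open>n\<close>.\<close>
  from assms(11) obtain \<xi> where h: "\<And>n. n \<in> I \<Longrightarrow> h n \<le> N n"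
    and \<xi>: "\<And>n. n \<in> I \<Longrightarrow> 0 \<le> \<xi> n" "\<And>n. n \<in> I \<Longrightarrow> \<xi> n \<le> 1" "exp_small I d \<xi>"
    and tol: "\<And>n \<psi> k. n \<in> I \<Longrightarrow> \<psi> \<in> unit_vectors (C n) \<Longrightarrow> k \<le> h n \<Longrightarrow>
      psd (2 ^ n) (R n (weight_channel n (N n) (E n) k (ket_bra \<psi>)) - of_real (1 - \<xi> n) \<cdot>\<^sub>m ket_bra \<psi>)"
    unfolding tolerable_error_weight_def by blast
  have "logical_error n (C n) (R n)
      (full_lindbladian n (N n) (rate n) (E n) (R n) (\<kappa> n) (\<Delta> n)) t
      \<le> 1 - exp (- (1 - \<xi> n) * real (N n) * \<Delta> n * s n 1 * t
        - \<xi> n * (\<kappa> n + real (N n) * \<Delta> n) * t)" if n: "n \<in> I" and t: "0 \<le> t" for n t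
    by (rule logical_error_bound[where h = "h n", OF assms(2)[OF n] assms(4)[OF n] assms(5)[OF n]
        assms(6)[OF n] assms(7)[OF n] assms(8)[OF n] assms(9)[OF n] assms(10)[OF n] \<xi>(1)[OF n]
        \<xi>(2)[OF n] h[OF n] tol[OF n] assms(13)[OF n] assms(14)[OF n]
        assms(15)[OF n, unfolded assms(12)[OF n]] t])
  with \<xi> show ?thesis by blast
qed

end
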